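(* Let $k$ be a field and let $\mathcal{D}$ be a weighted oriented graph that is the union of two distinct oriented cycles $\mathcal{C}_m$ and $\mathcal{C}_n$ (together with a connecting path in case (C)), satisfying one of the following: (A) $\mathcal{C}_m$ and $\mathcal{C}_n$ share exactly a single vertex (and no edges); (B) the set $E(\mathcal{C}_m)\cap E(\mathcal{C}_n)$ induces an oriented path with at least one edge, and $V(\mathcal{C}_m)\cap V(\mathcal{C}_n)$ is the vertex set of this path; (C) $\mathcal{C}_m$ and $\mathcal{C}_n$ are vertex-disjoint and are connected by an oriented path $\mathcal{P}_s$ of length $s\geq 1$, which meets $\mathcal{C}_m$ in exactly one of its endpoints and $\mathcal{C}_n$ in exactly its other endpoint. Then the toric ideal $I_{\mathcal{D}}$ is generated by a single element if and only if at most one of the cycles of $\mathcal{D}$ is balanced. (In cases (A) and (C) the cycles of $\mathcal{D}$ are $\mathcal{C}_m$ and $\mathcal{C}_n$; in case (B) there are three cycles: $\mathcal{C}_m$, $\mathcal{C}_n$, and the outer cycle with edge set the symmetric difference of $E(\mathcal{C}_m)$ and $E(\mathcal{C}_n)$.)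
   Context: Weighted oriented graph: $\mathcal{D}$ is a finite simple graph with vertices $x_1,\dots,x_\nu$ and edges $e_1,\dots,e_\mu$, each edge given one orientation ($(x_p,x_q)$ denotes an edge directed from $x_p$ to $x_q$), together with positive integer vertex weights $w_1,\dots,w_\nu$. The toric ideal $I_{\mathcal{D}}$ is the kernel of the $k$-algebra homomorphism $k[e_1,\dots,e_\mu]\to k[x_1,\dots,x_\nu]$ sending an edge $e=(x_p,x_q)$ to $x_p x_q^{w_q}$. The incidence matrix $A(\mathcal{D})=(a_{i,j})$ is the $\nu\times\mu$ matrix with $a_{i,j}=1$ if $e_j$ is directed out of $x_i$, $a_{i,j}=w_i$ if $e_j$ is directed into $x_i$, and $a_{i,j}=0$ otherwise. Oriented cycles and oriented paths are weighted oriented graphs whose underlying unoriented graph is a cycle (on at least three vertices) or a path; the edges may be oriented arbitrarily. The length of a path is its number of edges. A weighted oriented cycle on $n$ vertices, labeled so that $e_i$ joins $x_i$ and $x_{i+1}$ for $1\le i\le n$ with $x_{n+1}=x_1$, is balanced if $n$ is even and $\prod_{i=1}^{n}a_{i,i}=a_{1,n}\prod_{i=1}^{n-1}a_{i+1,i}$, where $(a_{i,j})$ is its incidence matrix. A cycle contained in a weighted oriented graph is balanced if it is balanced with the inherited orientation and weights. *)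

theory Defs
  imports "HOL-Algebra.RingHom" "HOL-Library.Poly_Mapping"
begin

section \<open>Weighted oriented graphs\<close>

text \<open>The arc \<open>(p, q)\<close> is directed from \<open>p\<close> to \<open>q\<close>.\<close>

record 'v wograph =
  verts :: "'v set"
  arcs :: "('v \<times> 'v) set"
  weight :: "'v \<Rightarrow> nat"

text \<open>The underlying graph is simple, and each of its edges carries exactly one
  orientation, so there are neither loops nor pairs of opposite arcs.\<close>

definition weighted_oriented_graph :: "'v wograph \<Rightarrow> bool" where
  "weighted_oriented_graph D \<longleftrightarrow>
     finite (verts D) \<and> arcs D \<subseteq> verts D \<times> verts D \<and>
     (\<forall>(p, q)\<in>arcs D. p \<noteq> q \<and> (q, p) \<notin> arcs D) \<and>
     (\<forall>x\<in>verts D. 0 < weight D x)"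

definition subgraph :: "'v wograph \<Rightarrow> 'v wograph \<Rightarrow> bool" where
  "subgraph C D \<longleftrightarrow> weighted_oriented_graph C \<and>
     verts C \<subseteq> verts D \<and> arcs C \<subseteq> arcs D \<and> weight C = weight D"

definition union_of :: "'v wograph \<Rightarrow> 'v wograph set \<Rightarrow> bool" where
  "union_of D \<C> \<longleftrightarrow> (\<forall>C\<in>\<C>. subgraph C D) \<and>
     verts D = (\<Union>C\<in>\<C>. verts C) \<and> arcs D = (\<Union>C\<in>\<C>. arcs C)"

definition edge_induced :: "'v wograph \<Rightarrow> ('v \<times> 'v) set \<Rightarrow> 'v wograph" where
  "edge_induced D F = \<lparr>verts = Field F, arcs = F, weight = weight D\<rparr>"

definition incidence :: "'v wograph \<Rightarrow> 'v \<Rightarrow> 'v \<times> 'v \<Rightarrow> nat" where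
  "incidence D x e = (if fst e = x then 1 else if snd e = x then weight D x else 0)"


section \<open>Oriented cycles and paths\<close>

definition joins :: "'v \<times> 'v \<Rightarrow> 'v \<Rightarrow> 'v \<Rightarrow> bool" where
  "joins e u v \<longleftrightarrow> e = (u, v) \<or> e = (v, u)"

text \<open>A labelling of a cycle on \<open>n\<close> vertices: the vertices are \<open>x 1, \<dots>, x n\<close>, the edges are
  \<open>e 1, \<dots>, e n\<close>, and \<open>e i\<close> joins \<open>x i\<close> and \<open>x (i + 1)\<close>, where \<open>x (n + 1) = x 1\<close>.\<close>

definition cycle_labelling ::
    "'v wograph \<Rightarrow> nat \<Rightarrow> (nat \<Rightarrow> 'v) \<Rightarrow> (nat \<Rightarrow> 'v \<times> 'v) \<Rightarrow> bool" where
  "cycle_labelling C n x e \<longleftrightarrow> 3 \<le> n \<and>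
     bij_betw x {1..n} (verts C) \<and> x (n + 1) = x 1 \<and>
     bij_betw e {1..n} (arcs C) \<and> (\<forall>i\<in>{1..n}. joins (e i) (x i) (x (i + 1)))"

definition oriented_cycle :: "'v wograph \<Rightarrow> bool" where
  "oriented_cycle C \<longleftrightarrow> weighted_oriented_graph C \<and> (\<exists>n x e. cycle_labelling C n x e)"

definition balanced :: "'v wograph \<Rightarrow> bool" where
  "balanced C \<longleftrightarrow> (\<exists>n x e. cycle_labelling C n x e \<and> even n \<and>
     (\<Prod>i=1..n. incidence C (x i) (e i)) =
       incidence C (x 1) (e n) * (\<Prod>i=1..n - 1. incidence C (x (i + 1)) (e i)))"

definition cycles :: "'v wograph \<Rightarrow> 'v wograph set" where
  "cycles D = {C. subgraph C D \<and> oriented_cycle C}"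

text \<open>A labelling of a path of length \<open>s\<close>: the vertices are \<open>x 0, \<dots>, x s\<close>, the edges are
  \<open>e 1, \<dots>, e s\<close>, and the endpoints are \<open>x 0\<close> and \<open>x s\<close>.\<close>

definition path_labelling ::
    "'v wograph \<Rightarrow> nat \<Rightarrow> (nat \<Rightarrow> 'v) \<Rightarrow> (nat \<Rightarrow> 'v \<times> 'v) \<Rightarrow> bool" where
  "path_labelling P s x e \<longleftrightarrow>
     bij_betw x {0..s} (verts P) \<and> bij_betw e {1..s} (arcs P) \<and>
     (\<forall>i\<in>{1..s}. joins (e i) (x (i - 1)) (x i))"


section \<open>Unions of two cycles\<close>

definition share_vertex :: "'v wograph \<Rightarrow> 'v wograph \<Rightarrow> 'v wograph \<Rightarrow> bool" where
  "share_vertex D C C' \<longleftrightarrow> union_of D {C, C'} \<and>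
     (\<exists>v. verts C \<inter> verts C' = {v}) \<and> arcs C \<inter> arcs C' = {}"

definition share_path :: "'v wograph \<Rightarrow> 'v wograph \<Rightarrow> 'v wograph \<Rightarrow> bool" where
  "share_path D C C' \<longleftrightarrow> union_of D {C, C'} \<and>
     (\<exists>P s x e. P = edge_induced D (arcs C \<inter> arcs C') \<and>
        1 \<le> s \<and> path_labelling P s x e \<and> verts C \<inter> verts C' = verts P)"

definition connected_by_path :: "'v wograph \<Rightarrow> 'v wograph \<Rightarrow> 'v wograph \<Rightarrow> bool" where
  "connected_by_path D C C' \<longleftrightarrow> verts C \<inter> verts C' = {} \<and>
     (\<exists>P s x e. union_of D {C, C', P} \<and> 1 \<le> s \<and> path_labelling P s x e \<and>
        verts P \<inter> verts C = {x 0} \<and> verts P \<inter> verts C' = {x s})"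

definition outer_cycle :: "'v wograph \<Rightarrow> 'v wograph \<Rightarrow> 'v wograph \<Rightarrow> 'v wograph" where
  "outer_cycle D C C' = edge_induced D ((arcs C - arcs C') \<union> (arcs C' - arcs C))"


section \<open>Polynomial rings and toric ideals\<close>

text \<open>Exponent vectors are finitely supported functions from variables to the naturals, and
  polynomials are finitely supported functions from exponent vectors to coefficients.\<close>

type_synonym ('x, 'k) mpoly = "('x \<Rightarrow>\<^sub>0 nat) \<Rightarrow>\<^sub>0 'k"

definition Const :: "'k \<Rightarrow> ('x, 'k::zero) mpoly" where
  "Const c = Poly_Mapping.single 0 c"

definition Var :: "'x \<Rightarrow> ('x, 'k::zero_neq_one) mpoly" where
  "Var x = Poly_Mapping.single (Poly_Mapping.single x 1) 1"

text \<open>The polynomial ring over \<open>'k\<close> whose variables are the elements of \<open>X\<close>; the type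
  \<open>'x\<close> may have further elements.\<close>

definition poly_ring :: "'x set \<Rightarrow> ('x, 'k::comm_ring_1) mpoly ring" where
  "poly_ring X =
     \<lparr>carrier = {p. \<forall>m\<in>Poly_Mapping.keys p. Poly_Mapping.keys m \<subseteq> X},
      mult = (*), one = 1, zero = 0, add = (+)\<rparr>"

text \<open>The algebra homomorphism that sends each variable \<open>x\<close> to \<open>f x\<close>.\<close>

definition insertion ::
    "('x \<Rightarrow> ('y, 'k) mpoly) \<Rightarrow> ('x, 'k::comm_ring_1) mpoly \<Rightarrow> ('y, 'k) mpoly" where
  "insertion f p = (\<Sum>m\<in>Poly_Mapping.keys p. Const (Poly_Mapping.lookup p m) *
     (\<Prod>x\<in>Poly_Mapping.keys m. f x ^ Poly_Mapping.lookup m x))"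

definition edge_monomial :: "'v wograph \<Rightarrow> 'v \<times> 'v \<Rightarrow> ('v, 'k::field) mpoly" where
  "edge_monomial D e = Var (fst e) * Var (snd e) ^ weight D (snd e)"

definition toric_ideal :: "'v wograph \<Rightarrow> ('v \<times> 'v, 'k::field) mpoly set" where
  "toric_ideal D = a_kernel (poly_ring (arcs D)) (poly_ring (verts D)) (insertion (edge_monomial D))"

lemma insertion_Const: "insertion f (Const c) = Const c"
  by (cases "c = 0") (simp_all add: insertion_def Const_def)

lemma insertion_Var: "insertion f (Var x) = f x"
  by (simp add: insertion_def Var_def Const_def)

lemma insertion_superset:
  assumes "finite A" "Poly_Mapping.keys p \<subseteq> A"
  shows "insertion f p = (\<Sum>m\<in>A. Const (Poly_Mapping.lookup p m) *
     (\<Prod>x\<in>Poly_Mapping.keys m. f x ^ Poly_Mapping.lookup m x))"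
  unfolding insertion_def
  by (rule sum.mono_neutral_left) (use assms in \<open>auto simp: Const_def in_keys_iff\<close>)

lemma insertion_add: "insertion f (p + q) = insertion f p + insertion f q"
proof -
  let ?A = "Poly_Mapping.keys p \<union> Poly_Mapping.keys q"
  have *: "finite ?A" "Poly_Mapping.keys p \<subseteq> ?A" "Poly_Mapping.keys q \<subseteq> ?A"
    "Poly_Mapping.keys (p + q) \<subseteq> ?A"
    using Poly_Mapping.keys_add[of p q] by auto
  show ?thesis
    by (simp only: insertion_superset[OF *(1,2)] insertion_superset[OF *(1,3)]
        insertion_superset[OF *(1,4)] sum.distrib[symmetric] lookup_add)
      (simp add: Const_def single_add algebra_simps)
qed

lemma power_prod_add:
  fixes f :: "'x \<Rightarrow> 'a::comm_monoid_mult"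
  shows "(\<Prod>x\<in>Poly_Mapping.keys (m + n). f x ^ Poly_Mapping.lookup (m + n) x) =
    (\<Prod>x\<in>Poly_Mapping.keys m. f x ^ Poly_Mapping.lookup m x) *
    (\<Prod>x\<in>Poly_Mapping.keys n. f x ^ Poly_Mapping.lookup n x)"
proof -
  let ?A = "Poly_Mapping.keys m \<union> Poly_Mapping.keys n"
  have *: "(\<Prod>x\<in>Poly_Mapping.keys k. f x ^ Poly_Mapping.lookup k x) =
      (\<Prod>x\<in>?A. f x ^ Poly_Mapping.lookup k x)" if "Poly_Mapping.keys k \<subseteq> ?A" for k
    by (rule prod.mono_neutral_left) (use that in \<open>auto simp: in_keys_iff\<close>)
  have k: "Poly_Mapping.keys (m + n) \<subseteq> ?A"
    by (rule Poly_Mapping.keys_add)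
  show ?thesis
    unfolding *[OF k] *[OF Un_upper1] *[OF Un_upper2]
    by (simp add: lookup_add power_add prod.distrib)
qed

lemma mpoly_induct [case_names single add]:
  assumes "\<And>m c. P (Poly_Mapping.single m c)" and "\<And>p q. P p \<Longrightarrow> P q \<Longrightarrow> P (p + q)"
  shows "P (p :: ('x, 'k::comm_ring_1) mpoly)"
proof (induction p rule: update_induct)
  case const
  show ?case using assms(1)[of 0 0] by simp
next
  case (update p m c)
  have "Poly_Mapping.update m c p = Poly_Mapping.single m c + p"
    using update.hyps
    by (intro poly_mapping_eqI)
      (auto simp: lookup_update lookup_add lookup_single in_keys_iff)
  then show ?case
    using assms(1) assms(2) update.IH by simp
qed

lemma insertion_single_mult:
  fixes f :: "'x \<Rightarrow> ('y, 'k::comm_ring_1) mpoly"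
  shows "insertion f (Poly_Mapping.single m c * q) =
     insertion f (Poly_Mapping.single m c) * insertion f q"
proof (induction q rule: mpoly_induct)
  case (single k v)
  have i: "insertion f (Poly_Mapping.single m c) = Const c *
      (\<Prod>x\<in>Poly_Mapping.keys m. f x ^ Poly_Mapping.lookup m x)" for m c
    by (cases "c = 0") (simp_all add: insertion_def Const_def)
  have "Const (c * v) = (Const c * Const v :: ('y, 'k) mpoly)"
    by (simp add: Const_def mult_single)
  then show ?case
    by (simp add: mult_single i power_prod_add mult_ac)
next
  case (add p q)
  then show ?case
    by (simp add: insertion_add distrib_left)
qed

lemma insertion_mult: "insertion f (p * q) = insertion f p * insertion f q"
proof (induction p rule: mpoly_induct)
  case (single k v)
  show ?case by (rule insertion_single_mult)
next
  case (add p q)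
  then show ?case
    by (simp add: insertion_add distrib_right)
qed

lemma cring_poly_ring: "cring (poly_ring X :: ('x, 'k::comm_ring_1) mpoly ring)"
proof (rule cringI)
  show "abelian_group (poly_ring X :: ('x, 'k) mpoly ring)"
  proof (rule abelian_groupI)
    fix p :: "('x, 'k) mpoly"
    assume "p \<in> carrier (poly_ring X)"
    moreover have "Poly_Mapping.keys (- p) = Poly_Mapping.keys p"
      by (auto simp: in_keys_iff)
    ultimately show "\<exists>q\<in>carrier (poly_ring X). q \<oplus>\<^bsub>poly_ring X\<^esub> p = \<zero>\<^bsub>poly_ring X\<^esub>"
      by (intro bexI[of _ "- p"]) (auto simp: poly_ring_def)
  qed (use Poly_Mapping.keys_add in \<open>force simp: poly_ring_def add_ac\<close>)+
next
  show "comm_monoid (poly_ring X :: ('x, 'k) mpoly ring)"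
  proof (rule comm_monoidI)
    fix p q :: "('x, 'k) mpoly"
    assume pq: "p \<in> carrier (poly_ring X)" "q \<in> carrier (poly_ring X)"
    have "Poly_Mapping.keys m \<subseteq> X" if m: "m \<in> Poly_Mapping.keys (p * q)" for m
    proof -
      obtain a b where "m = a + b" "a \<in> Poly_Mapping.keys p" "b \<in> Poly_Mapping.keys q"
        using Poly_Mapping.keys_mult[of p q] m by auto
      then show ?thesis
        using Poly_Mapping.keys_add[of a b] pq by (fastforce simp: poly_ring_def)
    qed
    then show "p \<otimes>\<^bsub>poly_ring X\<^esub> q \<in> carrier (poly_ring X)"
      by (simp add: poly_ring_def)
  qed (auto simp: poly_ring_def mult_ac)
qed (simp add: poly_ring_def distrib_right)

end

theory Submission
  imports Defs
begin

text \<open>The toric ideal is the lattice ideal of the integral kernel of the incidence matrix. The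
  entries of the matrix are positive at the ends of an edge, so no vertex lies on exactly one edge of
  the support of a kernel vector. Call an edge set with this property leafless. Cycles are minimal
  nonempty leafless sets, and a cycle supports a nonzero kernel vector iff it is balanced. In a union
  of two cycles as in (A), (B), (C), a nonempty leafless set that avoids some edge of a cycle is
  itself a cycle. Hence two independent kernel vectors yield two balanced cycles: eliminate an
  edge \<open>e\<^sub>1\<close> of some cycle, which leaves a kernel vector supported on a balanced cycle, and then
  eliminate an edge of that cycle. So if at most one cycle is balanced, the kernel is generated by one
  vector, and the ideal by its binomial. Conversely, if the ideal is generated by \<open>g\<close> and two
  cycles are balanced, then \<open>g\<close> divides the binomials of both and only involves their common
  edges; these support no kernel vector, so \<open>g = 0\<close>, a contradiction.\<close>

section \<open>Leafless edge sets and cycles\<close>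

text \<open>The edge \<open>e\<^sub>1\<close> must lie on a cycle: in case (C) the union of both
  cycles avoids the connecting path and is leafless without being a cycle, so eliminating a path
  edge would not isolate a balanced cycle. Balancedness measures one trip around a cycle. Each
  vertex equation relates two consecutive entries of a kernel vector with opposite signs, so
  returning to the first entry multiplies it by (-1)^n times a quotient of products of positive
  incidence entries. This factor is 1 exactly when the cycle is balanced. The generating vector need
  not live on a cycle: two triangles with unit weights sharing a vertex have no balanced cycle, yet
  their kernel is nonzero. Hence the generator is obtained by integer division at a single edge and
  not from a cycle. That \<open>g\<close> involves only common edges rests on a fact about factors:
  with a weight on monomials that compares the exponent of one chosen variable first, leading
  monomials multiply, so no variable of a factor can disappear from a nonzero product.\<close>

definition incident :: "'v \<Rightarrow> 'v \<times> 'v \<Rightarrow> bool" where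
  "incident x e \<longleftrightarrow> x = fst e \<or> x = snd e"

lemma joins_incident: "joins e u v \<Longrightarrow> incident x e \<longleftrightarrow> x = u \<or> x = v"
  by (auto simp: joins_def incident_def)

lemma joins_sym: "joins e u v \<longleftrightarrow> joins e v u"
  by (auto simp: joins_def)

definition leafless :: "('v \<times> 'v) set \<Rightarrow> bool" where
  "leafless F \<longleftrightarrow> (\<forall>x. \<forall>e\<in>F. incident x e \<longrightarrow> (\<exists>e'\<in>F. e' \<noteq> e \<and> incident x e'))"

text \<open>Having one of \<open>a\<close>, \<open>b\<close> without the other would make
  \<open>x\<close> a leaf. Propagation of membership along cycles and paths rests on this
  step.\<close>

lemma leafless_passage:
  assumes "leafless F" "\<And>e. e \<in> F \<Longrightarrow> incident x e \<Longrightarrow> e = a \<or> e = b"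
    "incident x a" "incident x b"
  shows "a \<in> F \<longleftrightarrow> b \<in> F"
  using assms unfolding leafless_def by metis

lemma membership_constant_on_interval:
  assumes step: "\<And>i. lo \<le> i \<Longrightarrow> i < hi \<Longrightarrow> e i \<in> F \<longleftrightarrow> e (i + 1) \<in> F"
    and jk: "j \<in> {lo..hi}" "k \<in> {lo..hi :: nat}"
  shows "e j \<in> F \<longleftrightarrow> e k \<in> F"
proof -
  have "e i \<in> F \<longleftrightarrow> e lo \<in> F" if "lo \<le> i" "i \<le> hi" for i
    using that by (induction i rule: dec_induct) (use step in auto)
  then show ?thesis using jk by (meson atLeastAtMost_iff)
qed

context
  fixes C :: "'v wograph" and n x e
  assumes lab: "cycle_labelling C n x e"
begin

lemma cycle_basics:
  shows cycle_length: "3 \<le> n" and cycle_wrap: "x (n + 1) = x 1" "x (Suc n) = x 1"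
    and cycle_inj_verts: "inj_on x {1..n}" and cycle_verts: "verts C = x ` {1..n}"
    and cycle_inj_arcs: "inj_on e {1..n}" and cycle_arcs: "arcs C = e ` {1..n}"
    and cycle_joins: "\<And>i. i \<in> {1..n} \<Longrightarrow> joins (e i) (x i) (x (i + 1))"
  using lab by (auto simp: cycle_labelling_def bij_betw_def)

lemma cycle_inj_iff:
  assumes "i \<in> {1..n}" "j \<in> {1..n}"
  shows "x i = x j \<longleftrightarrow> i = j" "e i = e j \<longleftrightarrow> i = j"
  using assms cycle_inj_verts cycle_inj_arcs by (auto dest: inj_onD)

text \<open>Injectivity of \<open>x\<close> covers only the labels 1 to \<open>n\<close>, so label
  \<open>n + 1\<close> has to be read as 1. The vertex \<open>x 1\<close>, whose edges are
  \<open>e n\<close> and \<open>e 1\<close>, is treated separately in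
  \<open>cycle_incident_first\<close>.\<close>

lemma cycle_incident:
  assumes i: "1 \<le> i" "i < n" and a: "a \<in> arcs C" "incident (x (i + 1)) a"
  shows "a = e i \<or> a = e (i + 1)"
proof -
  obtain j where j: "j \<in> {1..n}" "a = e j" using a cycle_arcs by auto
  then have "x (i + 1) = x j \<or> x (i + 1) = x (j + 1)"
    using a(2) cycle_joins joins_incident by metis
  then have "i + 1 = j \<or> i = j"
  proof
    assume *: "x (i + 1) = x (j + 1)"
    show ?thesis
    proof (cases "j = n")
      case True
      then show ?thesis using * cycle_wrap cycle_inj_iff(1)[of "i + 1" 1] i by auto
    next
      case False
      then show ?thesis using * cycle_inj_iff(1)[of "i + 1" "j + 1"] i j by auto
    qed
  qed (use cycle_inj_iff(1)[of "i + 1" j] i j in auto)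
  then show ?thesis using j by auto
qed

lemma cycle_incident_first:
  assumes a: "a \<in> arcs C" "incident (x 1) a"
  shows "a = e n \<or> a = e 1"
proof -
  obtain j where j: "j \<in> {1..n}" "a = e j" using a cycle_arcs by auto
  then have "x 1 = x j \<or> x 1 = x (j + 1)"
    using a(2) cycle_joins joins_incident by metis
  then have "j = 1 \<or> j = n"
  proof
    assume "x 1 = x (j + 1)"
    then show ?thesis using cycle_inj_iff(1)[of 1 "j + 1"] j by (cases "j = n") auto
  qed (use cycle_inj_iff(1)[of 1 j] j in auto)
  then show ?thesis using j by auto
qed

lemma cycle_incident_self:
  assumes "1 \<le> i" "i \<le> n"
  shows "incident (x i) (e i)" "incident (x (i + 1)) (e i)" "incident (x (Suc i)) (e i)"
  using cycle_joins[of i] assms joins_incident by fastforce+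

lemma cycle_incident_last: "incident (x 1) (e n)"
  using cycle_incident_self(2)[of n] cycle_length cycle_wrap by simp

lemma cycle_incident_verts:
  assumes "a \<in> arcs C" "incident v a" shows "v \<in> verts C"
proof -
  obtain j where j: "j \<in> {1..n}" "a = e j" using assms cycle_arcs by auto
  then have "v = x j \<or> v = x (j + 1)" using assms(2) cycle_joins joins_incident by metis
  moreover have "x (j + 1) \<in> x ` {1..n}"
    using j cycle_wrap by (cases "j = n") auto
  ultimately show ?thesis using j cycle_verts by auto
qed

lemma cycle_Field: "verts C = Field (arcs C)"
proof
  show "verts C \<subseteq> Field (arcs C)"
  proof
    fix v assume "v \<in> verts C"
    then obtain i where i: "i \<in> {1..n}" "v = x i" using cycle_verts by auto
    with cycle_joins[of i] cycle_arcs have "joins (e i) v (x (i + 1))" "e i \<in> arcs C" by auto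
    then show "v \<in> Field (arcs C)" by (auto simp: joins_def Field_def)
  qed
  show "Field (arcs C) \<subseteq> verts C"
    using cycle_incident_verts by (fastforce simp: Field_def incident_def)
qed

lemma cycle_leafless: "leafless (arcs C)"
  unfolding leafless_def
proof (intro allI ballI impI)
  fix v a assume a: "a \<in> arcs C" "incident v a"
  obtain i where i: "i \<in> {1..n}" "v = x i"
    using cycle_incident_verts[OF a] cycle_verts by auto
  show "\<exists>e'\<in>arcs C. e' \<noteq> a \<and> incident v e'"
  proof (cases "i = 1")
    case True
    have "e n \<noteq> e 1" using cycle_inj_iff(2)[of n 1] cycle_length by auto
    moreover have "e n \<in> arcs C" "e 1 \<in> arcs C" using cycle_arcs cycle_length by auto
    moreover have "incident v (e 1)" "incident v (e n)"
      using True i cycle_incident_self(1)[of 1] cycle_incident_last cycle_length by auto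
    ultimately show ?thesis by metis
  next
    case False
    then obtain k where k: "i = k + 1" "1 \<le> k" "k < n" using i by (cases i) auto
    have "e k \<noteq> e (k + 1)" using cycle_inj_iff(2)[of k "k + 1"] k by auto
    moreover have "e k \<in> arcs C" "e (k + 1) \<in> arcs C" using cycle_arcs k by auto
    moreover have "incident v (e k)" "incident v (e (k + 1))"
      using k i cycle_incident_self(2)[of k] cycle_incident_self(1)[of "k + 1"] by auto
    ultimately show ?thesis by metis
  qed
qed

text \<open>The condition is local: only at \<open>x (i + 1)\<close> must \<open>F\<close> stay on
  the cycle. Elsewhere it may branch off, so propagation can run between two attaching
  vertices.\<close>

lemma leafless_cycle_passage:
  assumes "leafless F" "1 \<le> i" "i < n" "\<And>a. a \<in> F \<Longrightarrow> incident (x (i + 1)) a \<Longrightarrow> a \<in> arcs C"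
  shows "e i \<in> F \<longleftrightarrow> e (i + 1) \<in> F"
  using assms cycle_incident cycle_incident_self
  by (intro leafless_passage[of F "x (i + 1)"]) auto

text \<open>Each vertex offers only two edges, so membership in \<open>F\<close> passes from
  \<open>e 1\<close> through to \<open>e n\<close>: all or nothing.\<close>

lemma cycle_minimal:
  assumes "F \<subseteq> arcs C" "leafless F" "F \<noteq> {}"
  shows "F = arcs C"
proof -
  have "e i \<in> F \<longleftrightarrow> e (i + 1) \<in> F" if "1 \<le> i" "i < n" for i
    using leafless_cycle_passage[OF assms(2) that] assms(1) by blast
  then have "e j \<in> F \<longleftrightarrow> e k \<in> F" if "j \<in> {1..n}" "k \<in> {1..n}" for j k
    using membership_constant_on_interval[of 1 n e F j k] that by blast
  moreover obtain j where "j \<in> {1..n}" "e j \<in> F" using assms(1,3) unfolding cycle_arcs by blast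
  ultimately have "e ` {1..n} \<subseteq> F" by blast
  then show ?thesis using assms(1) unfolding cycle_arcs by (rule equalityI[rotated])
qed

section \<open>Changing the starting point and the direction of a cycle labelling\<close>

lemma cycle_rotate:
  "\<exists>x' e'. cycle_labelling C n x' e' \<and> (\<forall>i\<in>{1..n}. x' i = x (i + 1)) \<and> (\<forall>i\<in>{1..<n}. e' i = e (i + 1))
     \<and> x' (n + 1) = x 2"
proof -
  define \<sigma> where "\<sigma> i = (if i = n then 1 else i + 1)" for i
  \<comment> \<open>The label at \<open>n + 1\<close> must repeat \<open>x' 1 = x 2\<close>; the
    value \<open>x (n + 2)\<close> is not constrained by a labelling.\<close>
  define x' where "x' i = (if i \<le> n then x (i + 1) else x 2)" for i
  define e' where "e' i = e (\<sigma> i)" for i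
  have n3: "3 \<le> n" by (rule cycle_length)
  have \<sigma>: "bij_betw \<sigma> {1..n} {1..n}"
    unfolding bij_betw_def
  proof
    show inj: "inj_on \<sigma> {1..n}" by (auto simp: inj_on_def \<sigma>_def split: if_splits)
    have "\<sigma> ` {1..n} \<subseteq> {1..n}" by (auto simp: \<sigma>_def)
    then show "\<sigma> ` {1..n} = {1..n}" using inj by (simp add: endo_inj_surj)
  qed
  have "x' i = (x \<circ> \<sigma>) i" if "i \<in> {1..n}" for i
    using that cycle_wrap by (auto simp: x'_def \<sigma>_def)
  then have bx: "bij_betw x' {1..n} (verts C)"
    using bij_betw_trans[OF \<sigma>, of x "verts C"] lab
    by (subst bij_betw_cong[where g = "x \<circ> \<sigma>"]) (auto simp: cycle_labelling_def)
  have be: "bij_betw e' {1..n} (arcs C)"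
    using bij_betw_trans[OF \<sigma>, of e "arcs C"] lab
    by (subst bij_betw_cong[where g = "e \<circ> \<sigma>"]) (auto simp: cycle_labelling_def e'_def)
  have j: "joins (e' i) (x' i) (x' (i + 1))" if "i \<in> {1..n}" for i
  proof (cases "i = n")
    case True
    then show ?thesis using cycle_joins[of 1] n3 cycle_wrap
      by (auto simp: x'_def e'_def \<sigma>_def numeral_2_eq_2)
  next
    case False
    then show ?thesis using cycle_joins[of "i + 1"] that by (auto simp: x'_def e'_def \<sigma>_def)
  qed
  have "cycle_labelling C n x' e'"
    using bx be j n3 by (auto simp: cycle_labelling_def x'_def numeral_2_eq_2)
  then show ?thesis
    by (intro exI[of _ x'] exI[of _ e']) (simp add: x'_def e'_def \<sigma>_def)
qed

text \<open>The offset \<open>n + 2\<close> keeps the starting vertex, since label 1 goes to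
  \<open>n + 1\<close> and \<open>x (n + 1) = x 1\<close>. Inside the proof the permutation is
  patched at 1 to stay within 1 to \<open>n\<close>.\<close>

lemma cycle_reflect: "cycle_labelling C n (\<lambda>i. x (n + 2 - i)) (\<lambda>i. e (n + 1 - i))"
proof -
  have n3: "3 \<le> n" by (rule cycle_length)
  have be: "bij_betw (\<lambda>i. e (n + 1 - i)) {1..n} (arcs C)"
  proof -
    have "bij_betw (\<lambda>i. n + 1 - i) {1..n} {1..n}"
      by (rule bij_betw_byWitness[where f' = "\<lambda>i. n + 1 - i"]) auto
    from bij_betw_trans[OF this, of e "arcs C"] show ?thesis
      using lab by (simp add: cycle_labelling_def comp_def)
  qed
  have bx: "bij_betw (\<lambda>i. x (n + 2 - i)) {1..n} (verts C)"
  proof -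
    have "bij_betw (\<lambda>i. if i = 1 then 1 else n + 2 - i) {1..n} {1..n}"
      by (rule bij_betw_byWitness[where f' = "\<lambda>i. if i = 1 then 1 else n + 2 - i"]) auto
    from bij_betw_trans[OF this, of x "verts C"]
    have "bij_betw (x \<circ> (\<lambda>i. if i = 1 then 1 else n + 2 - i)) {1..n} (verts C)"
      using lab by (simp add: cycle_labelling_def)
    then show ?thesis
      by (subst bij_betw_cong[where g = "x \<circ> (\<lambda>i. if i = 1 then 1 else n + 2 - i)"]) (auto simp: cycle_wrap)
  qed
  have "joins (e (n + 1 - i)) (x (n + 2 - i)) (x (n + 2 - (i + 1)))" if "i \<in> {1..n}" for i
    using cycle_joins[of "n + 1 - i"] that
    by (subst joins_sym) (auto simp: Suc_diff_le)
  then show ?thesis using n3 be bx by (auto simp: cycle_labelling_def cycle_wrap)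
qed

end

lemma cycle_rotate_to:
  assumes "cycle_labelling C n x e" "1 \<le> j" "j \<le> n"
  shows "\<exists>x' e'. cycle_labelling C n x' e' \<and> x' 1 = x j \<and> x' 2 = x (j + 1) \<and> e' 1 = e j"
  using assms(2,1,3)
proof (induction j arbitrary: x e rule: dec_induct)
  case base
  then show ?case by (intro exI[of _ x] exI[of _ e]) (auto simp: numeral_2_eq_2)
next
  case (step j)
  obtain x' e' where 1: "cycle_labelling C n x' e'" "\<forall>i\<in>{1..n}. x' i = x (i + 1)"
    "\<forall>i\<in>{1..<n}. e' i = e (i + 1)"
    using cycle_rotate[OF step.prems(1)] by blast
  then have "x' j = x (Suc j)" "x' (j + 1) = x (Suc j + 1)" "e' j = e (Suc j)"
    using step by auto
  then show ?case using step.IH[OF 1(1)] step.prems by auto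
qed

lemma cycle_start_at:
  assumes "cycle_labelling C n x e" "v \<in> verts C"
  shows "\<exists>x' e'. cycle_labelling C n x' e' \<and> x' 1 = v"
proof -
  obtain j where "1 \<le> j" "j \<le> n" "v = x j"
    using assms(2) cycle_verts[OF assms(1)] by auto
  then show ?thesis using cycle_rotate_to[OF assms(1), of j] by auto
qed

text \<open>A path made of cycle edges can only follow the cycle. Rotation and, if necessary,
  reflection match the first edge with its direction; after that, the next path edge is one of the
  two cycle edges at the current vertex and differs from the previous one. The bound
  \<open>s < n\<close> holds because \<open>s + 1\<close> distinct path vertices lie on the
  cycle.\<close>

lemma cycle_align:
  assumes lab: "cycle_labelling C n x e" and s: "1 \<le> s"
    and y: "inj_on y {0..s}" and f: "inj_on f {1..s}" "f ` {1..s} \<subseteq> arcs C"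
    and j: "\<And>i. i \<in> {1..s} \<Longrightarrow> joins (f i) (y (i - 1)) (y i)"
  shows "s < n \<and> (\<exists>x e. cycle_labelling C n x e \<and> (\<forall>i\<in>{0..s}. x (i + 1) = y i) \<and> (\<forall>i\<in>{1..s}. e i = f i))"
proof -
  have "y i \<in> verts C" if "i \<in> {0..s}" for i
  proof (cases "i = 0")
    case True
    then show ?thesis
      using j[of 1] s f(2) cycle_incident_verts[OF lab, of "f 1" "y 0"]
      by (auto simp: joins_incident image_subset_iff)
  next
    case False
    then show ?thesis
      using j[of i] s f(2) that cycle_incident_verts[OF lab, of "f i" "y i"]
      by (auto simp: joins_incident image_subset_iff)
  qed
  then have "card (y ` {0..s}) \<le> card (verts C)"
    using cycle_verts[OF lab] by (intro card_mono) auto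
  then have sn: "s < n"
    using y cycle_inj_verts[OF lab] cycle_verts[OF lab] by (simp add: card_image)
  obtain x1 e1 where 1: "cycle_labelling C n x1 e1" "e1 1 = f 1"
  proof -
    have "f 1 \<in> e ` {1..n}" using f(2) s cycle_arcs[OF lab] by auto
    then obtain k where "k \<in> {1..n}" "e k = f 1" by (metis imageE)
    then show thesis using that cycle_rotate_to[OF lab, of k] by auto
  qed
  have j1: "joins (f 1) (x1 1) (x1 2)" "joins (f 1) (y 0) (y 1)"
    using cycle_joins[OF 1(1), of 1] 1(2) cycle_length[OF 1(1)] j[of 1] s by (auto simp: numeral_2_eq_2)
  obtain x2 e2 where 2: "cycle_labelling C n x2 e2" "e2 1 = f 1" "x2 1 = y 0" "x2 2 = y 1"
  proof (cases "x1 1 = y 0")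
    case True
    then have "x1 2 = y 1" using j1 by (auto simp: joins_def)
    then show thesis using that 1 True by blast
  next
    case False
    then have *: "x1 1 = y 1" "x1 2 = y 0" using j1 by (auto simp: joins_def)
    \<comment> \<open>Reflection moves edge 1 to position \<open>n\<close>. Starting there, the
      first vertex is \<open>x1 2 = y 0\<close> and the second is \<open>x1 1 = y 1\<close>.\<close>
    obtain x2 e2 where "cycle_labelling C n x2 e2" "x2 1 = x1 (n + 2 - n)" "x2 2 = x1 (n + 2 - (n + 1))"
      "e2 1 = e1 (n + 1 - n)"
      using cycle_rotate_to[OF cycle_reflect[OF 1(1)], of n] sn by auto
    then show thesis using that 1 * by auto
  qed
  have "x2 (i + 1) = y i \<and> e2 i = f i \<and> x2 i = y (i - 1)" if "1 \<le> i" "i \<le> s" for i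
    using that
  proof (induction i rule: dec_induct)
    case base
    then show ?case using 2 by (simp add: numeral_2_eq_2)
  next
    case (step i)
    then have IH: "x2 (i + 1) = y i" "e2 i = f i" by auto
    have ji: "joins (f (i + 1)) (y i) (y (i + 1))" using j[of "i + 1"] step by auto
    have "f (i + 1) \<in> arcs C" using f(2) step by auto
    moreover have "incident (x2 (i + 1)) (f (i + 1))" using ji IH joins_incident by metis
    ultimately have "f (i + 1) = e2 i \<or> f (i + 1) = e2 (i + 1)"
      using cycle_incident[OF 2(1), of i "f (i + 1)"] step sn by auto
    moreover have "f (i + 1) \<noteq> f i" using f(1) step by (auto dest: inj_onD)
    ultimately have e: "e2 (i + 1) = f (i + 1)" using IH by auto
    have "joins (f (i + 1)) (y i) (x2 (i + 2))"
      using cycle_joins[OF 2(1), of "i + 1"] e IH step sn by auto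
    then have "x2 (i + 2) = y (i + 1)" using ji by (auto simp: joins_def)
    then show ?case using e IH by auto
  qed
  note * = this
  have "\<forall>i\<in>{0..s}. x2 (i + 1) = y i"
  proof
    fix i assume "i \<in> {0..s}"
    then show "x2 (i + 1) = y i" using 2(3) *[of i] by (cases "i = 0") auto
  qed
  moreover have "\<forall>i\<in>{1..s}. e2 i = f i" using * by auto
  ultimately show ?thesis using 2(1) sn by blast
qed

lemma cycle_labellingI:
  assumes "3 \<le> n" "inj_on x {1..n}" "x (n + 1) = x 1" "inj_on e {1..n}" "e ` {1..n} = A"
    and j: "\<And>i. i \<in> {1..n} \<Longrightarrow> joins (e i) (x i) (x (i + 1))"
  shows "cycle_labelling \<lparr>verts = Field A, arcs = A, weight = w\<rparr> n x e"
proof -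
  have "Field A = (\<Union>a\<in>e ` {1..n}. {fst a, snd a})"
    unfolding assms(5) by (auto simp: Field_def)
  also have "\<dots> = (\<Union>i\<in>{1..n}. {fst (e i), snd (e i)})" by simp
  also have "\<dots> = (\<Union>i\<in>{1..n}. {x i, x (i + 1)})"
  proof (rule SUP_cong)
    fix i assume "i \<in> {1..n}"
    then show "{fst (e i), snd (e i)} = {x i, x (i + 1)}"
      using j[of i] by (auto simp: joins_def)
  qed simp
  also have "\<dots> = x ` {1..n}"
  proof -
    have "x (i + 1) \<in> x ` {1..n}" if "i \<in> {1..n}" for i
      using that assms(1,3) by (cases "i = n") auto
    then show ?thesis by auto
  qed
  finally have "Field A = x ` {1..n}" .
  then show ?thesis using assms by (simp add: cycle_labelling_def bij_betw_def)
qed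

section \<open>Leafless edge sets in a union of two cycles\<close>

text \<open>If \<open>F\<close> can leave the cycle only at \<open>v\<close>, a labelling starting
  at \<open>v\<close> allows passage at every vertex between \<open>e 1\<close> and
  \<open>e n\<close>. So \<open>F\<close> takes all edges of the cycle or none, and \<open>a\<close>
  rules out all.\<close>

lemma cycle_cut:
  assumes C: "cycle_labelling C n x e" and F: "leafless F"
    and own: "\<And>w a. a \<in> F \<Longrightarrow> w \<in> verts C \<Longrightarrow> w \<noteq> v \<Longrightarrow> incident w a \<Longrightarrow> a \<in> arcs C"
    and a: "a \<in> arcs C" "a \<notin> F"
  shows "F \<inter> arcs C = {}"
proof -
  obtain x e where lab: "cycle_labelling C n x e" and v: "\<And>i. 1 \<le> i \<Longrightarrow> i < n \<Longrightarrow> x (i + 1) \<noteq> v"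
  proof (cases "v \<in> verts C")
    case True
    then obtain x' e' where 1: "cycle_labelling C n x' e'" "x' 1 = v"
      using cycle_start_at[OF C] by blast
    have "x' (i + 1) \<noteq> v" if "1 \<le> i" "i < n" for i
      using cycle_inj_iff(1)[OF 1(1), of "i + 1" 1] 1(2) that by auto
    then show thesis using that 1(1) by blast
  next
    case False
    have "x (i + 1) \<noteq> v" if "1 \<le> i" "i < n" for i
      using False that cycle_verts[OF C] by auto
    then show thesis using that C by blast
  qed
  have "e i \<in> F \<longleftrightarrow> e (i + 1) \<in> F" if i: "1 \<le> i" "i < n" for i
  proof (rule leafless_cycle_passage[OF lab F i])
    fix b assume "b \<in> F" "incident (x (i + 1)) b"
    moreover have "x (i + 1) \<in> verts C" using cycle_verts[OF lab] i by auto
    ultimately show "b \<in> arcs C" using own v i by blast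
  qed
  then have "e j \<in> F \<longleftrightarrow> e k \<in> F" if "j \<in> {1..n}" "k \<in> {1..n}" for j k
    using membership_constant_on_interval[of 1 n e F j k] that by blast
  note * = this
  obtain k where k: "k \<in> {1..n}" "a = e k" using a(1) cycle_arcs[OF lab] by auto
  then have "e j \<notin> F" if "j \<in> {1..n}" for j using *[OF that k(1)] a(2) by simp
  then show ?thesis using cycle_arcs[OF lab] by auto
qed

lemma oriented_cycleE:
  assumes "oriented_cycle C" obtains n x e where "cycle_labelling C n x e"
  using assms unfolding oriented_cycle_def by blast

lemma incident_verts:
  assumes "weighted_oriented_graph D" "a \<in> arcs D" "incident v a" shows "v \<in> verts D"
  using assms by (fastforce simp: weighted_oriented_graph_def incident_def)

text \<open>\<open>C\<close> is attached to the rest at one vertex only, so missing \<open>a\<close>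
  means missing all of \<open>C\<close>; minimality of \<open>C'\<close> finishes.\<close>

lemma leafless_avoiding_share_vertex:
  assumes C: "oriented_cycle C" and C': "oriented_cycle C'" and sh: "share_vertex D C C'"
    and F: "F \<subseteq> arcs D" "leafless F" "F \<noteq> {}" and a: "a \<in> arcs C" "a \<notin> F"
  shows "F = arcs C'"
proof -
  obtain n x e where L: "cycle_labelling C n x e" using C by (rule oriented_cycleE)
  obtain n' x' e' where L': "cycle_labelling C' n' x' e'" using C' by (rule oriented_cycleE)
  obtain v where v: "verts C \<inter> verts C' = {v}" and D: "arcs D = arcs C \<union> arcs C'"
    using sh by (auto simp: share_vertex_def union_of_def)
  have "F \<inter> arcs C = {}"
  proof (rule cycle_cut[OF L F(2) _ a, of v])
    fix w b assume "b \<in> F" "w \<in> verts C" "w \<noteq> v" "incident w b"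
    moreover have "w \<notin> verts C'" using v calculation by blast
    ultimately show "b \<in> arcs C" using cycle_incident_verts[OF L'] F(1) D by blast
  qed
  then show ?thesis using cycle_minimal[OF L' _ F(2,3)] F(1) D by blast
qed

text \<open>The definition directs the path labelling from \<open>C\<close> to \<open>C'\<close>.
  Vertices are counted from 0 and edges from 1, hence the two different reversals.\<close>

lemma connected_by_path_sym:
  assumes "connected_by_path D C C'" shows "connected_by_path D C' C"
proof -
  obtain P s x e where P: "verts C \<inter> verts C' = {}" "union_of D {C, C', P}" "1 \<le> s"
    "path_labelling P s x e" "verts P \<inter> verts C = {x 0}" "verts P \<inter> verts C' = {x s}"
    using assms unfolding connected_by_path_def by blast
  have "bij_betw (\<lambda>i. s - i) {0..s} {0..s}"
    by (rule bij_betw_byWitness[where f' = "\<lambda>i. s - i"]) auto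
  from bij_betw_trans[OF this, of x "verts P"]
  have x: "bij_betw (\<lambda>i. x (s - i)) {0..s} (verts P)"
    using P(4) by (simp add: path_labelling_def comp_def)
  have "bij_betw (\<lambda>i. s + 1 - i) {1..s} {1..s}"
    by (rule bij_betw_byWitness[where f' = "\<lambda>i. s + 1 - i"]) auto
  from bij_betw_trans[OF this, of e "arcs P"]
  have e: "bij_betw (\<lambda>i. e (s + 1 - i)) {1..s} (arcs P)"
    using P(4) by (simp add: path_labelling_def comp_def)
  have "joins (e (s + 1 - i)) (x (s - (i - 1))) (x (s - i))" if i: "i \<in> {1..s}" for i
  proof -
    have "s + 1 - i \<in> {1..s}" "s - (i - 1) = s + 1 - i" "s - i = s + 1 - i - 1" using i by auto
    then show ?thesis using P(4) joins_sym unfolding path_labelling_def by metis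
  qed
  then have "path_labelling P s (\<lambda>i. x (s - i)) (\<lambda>i. e (s + 1 - i))"
    using x e by (simp add: path_labelling_def)
  moreover have "union_of D {C', C, P}" using P(2) by (simp add: insert_commute)
  moreover have "verts C' \<inter> verts C = {}" using P(1) by blast
  ultimately show ?thesis
    unfolding connected_by_path_def using P(3,5,6)
    by (intro conjI exI[of _ P] exI[of _ s] exI[of _ "\<lambda>i. x (s - i)"] exI[of _ "\<lambda>i. e (s + 1 - i)"]) auto
qed

text \<open>Once \<open>C\<close> is excluded, the end \<open>y 0\<close> of the connecting path is
  a dead end. Leaflessness then peels off the path edge by edge towards \<open>C'\<close>.\<close>

lemma leafless_avoiding_connected:
  assumes C: "oriented_cycle C" and C': "oriented_cycle C'" and con: "connected_by_path D C C'"
    and F: "F \<subseteq> arcs D" "leafless F" "F \<noteq> {}" and a: "a \<in> arcs C" "a \<notin> F"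
  shows "F = arcs C'"
proof -
  obtain n x e where L: "cycle_labelling C n x e" using C by (rule oriented_cycleE)
  obtain n' x' e' where L': "cycle_labelling C' n' x' e'" using C' by (rule oriented_cycleE)
  obtain P s y f where disj: "verts C \<inter> verts C' = {}" and U: "union_of D {C, C', P}" and s: "1 \<le> s"
    and P: "path_labelling P s y f" and ends: "verts P \<inter> verts C = {y 0}" "verts P \<inter> verts C' = {y s}"
    using con unfolding connected_by_path_def by blast
  have D: "arcs D = arcs C \<union> arcs C' \<union> arcs P" and wP: "weighted_oriented_graph P"
    using U by (auto simp: union_of_def subgraph_def)
  have y: "inj_on y {0..s}" "y ` {0..s} = verts P" and f: "f ` {1..s} = arcs P"
    and j: "\<And>i. i \<in> {1..s} \<Longrightarrow> joins (f i) (y (i - 1)) (y i)"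
    using P by (auto simp: path_labelling_def bij_betw_def)
  have FC: "F \<inter> arcs C = {}"
  proof (rule cycle_cut[OF L F(2) _ a, of "y 0"])
    fix w b assume w: "b \<in> F" "w \<in> verts C" "w \<noteq> y 0" "incident w b"
    then have "w \<notin> verts C'" "w \<notin> verts P" using disj ends by auto
    then show "b \<in> arcs C"
      using cycle_incident_verts[OF L'] incident_verts[OF wP] w F(1) D by blast
  qed
  \<comment> \<open>At \<open>y i\<close> the path has no edges except \<open>f i\<close> and
    \<open>f (i + 1)\<close>. For \<open>i = 0\<close> the conclusion \<open>k = 0\<close>
    contradicts the range of \<open>k\<close>, so \<open>f 1\<close> is the only path edge
    there.\<close>
  have Pinc: "k = i" if "i \<in> {0..s}" "k \<in> {1..s}" "incident (y i) (f k)" "k \<noteq> i + 1" for i k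
  proof -
    have "y i = y (k - 1) \<or> y i = y k" using joins_incident[OF j[OF that(2)]] that(3) by blast
    then have "i = k - 1 \<or> i = k" using y(1) that by (auto dest: inj_onD)
    then show ?thesis using that by auto
  qed
  have "f i \<notin> F" if "1 \<le> i" "i \<le> s" for i
    using that
  proof (induction i rule: dec_induct)
    case base
    show ?case
    proof
      assume f1: "f 1 \<in> F"
      have inc: "incident (y 0) (f 1)" using joins_incident[OF j[of 1]] s by auto
      then obtain b where b: "b \<in> F" "b \<noteq> f 1" "incident (y 0) b"
        using F(2) f1 unfolding leafless_def by blast
      have "y 0 \<notin> verts C'" using ends disj by blast
      then have "b \<in> arcs P" using b cycle_incident_verts[OF L'] FC F(1) D by blast
      then obtain k where k: "k \<in> {1..s}" "b = f k" using f by blast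
      then show False using Pinc[of 0 k] b by auto
    qed
  next
    case (step i)
    show ?case
    proof
      assume f1: "f (Suc i) \<in> F"
      have inc: "incident (y i) (f (Suc i))" using joins_incident[OF j[of "Suc i"]] step by auto
      then obtain b where b: "b \<in> F" "b \<noteq> f (Suc i)" "incident (y i) b"
        using F(2) f1 unfolding leafless_def by blast
      have "y i \<noteq> y s" "y i \<in> verts P" using y step by (auto dest: inj_onD)
      then have "y i \<notin> verts C'" using ends by blast
      then have "b \<in> arcs P" using b cycle_incident_verts[OF L'] FC F(1) D by blast
      then obtain k where k: "k \<in> {1..s}" "b = f k" using f by blast
      then have "k = i" using Pinc[of i k] b step by auto
      then show False using b k step by auto
    qed
  qed
  then have "F \<inter> arcs P = {}" unfolding f[symmetric] by auto
  then have "F \<subseteq> arcs C'" using FC F(1) D by blast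
  then show ?thesis using cycle_minimal[OF L' _ F(2,3)] by blast
qed

text \<open>Aligning both cycles with one labelling of the common path makes them start at the same
  vertex, traverse that path in the same direction, and use identical labels on it.\<close>

lemma share_path_labels:
  assumes C: "oriented_cycle C" and C': "oriented_cycle C'" and sh: "share_path D C C'"
  obtains s m n x e z g where
    "cycle_labelling C m x e" "cycle_labelling C' n z g" "1 \<le> s" "s < m" "s < n"
    "\<And>i. i \<in> {1..s + 1} \<Longrightarrow> x i = z i" "\<And>i. i \<in> {1..s} \<Longrightarrow> e i = g i"
    "arcs C \<inter> arcs C' = e ` {1..s}" "verts C \<inter> verts C' = x ` {1..s + 1}"
proof -
  obtain s y f where s: "1 \<le> s" and P: "path_labelling (edge_induced D (arcs C \<inter> arcs C')) s y f"
    and V: "verts C \<inter> verts C' = Field (arcs C \<inter> arcs C')"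
    using sh unfolding share_path_def by (auto simp: edge_induced_def)
  have y: "inj_on y {0..s}" "y ` {0..s} = verts C \<inter> verts C'"
    and f: "inj_on f {1..s}" "f ` {1..s} = arcs C \<inter> arcs C'"
    and j: "\<And>i. i \<in> {1..s} \<Longrightarrow> joins (f i) (y (i - 1)) (y i)"
    using P V by (auto simp: path_labelling_def bij_betw_def edge_induced_def)
  have f': "f ` {1..s} \<subseteq> arcs C" "f ` {1..s} \<subseteq> arcs C'" using f(2) by auto
  obtain m x0 e0 where "cycle_labelling C m x0 e0" using C by (rule oriented_cycleE)
  from cycle_align[OF this s y(1) f(1) f'(1) j]
  obtain x e where 1: "s < m" "cycle_labelling C m x e" "\<forall>i\<in>{0..s}. x (i + 1) = y i" "\<forall>i\<in>{1..s}. e i = f i"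
    by blast
  obtain n z0 g0 where "cycle_labelling C' n z0 g0" using C' by (rule oriented_cycleE)
  from cycle_align[OF this s y(1) f(1) f'(2) j]
  obtain z g where 2: "s < n" "cycle_labelling C' n z g" "\<forall>i\<in>{0..s}. z (i + 1) = y i" "\<forall>i\<in>{1..s}. g i = f i"
    by blast
  have xy: "x i = y (i - 1)" "z i = y (i - 1)" if "i \<in> {1..s + 1}" for i
    using that 1(3)[rule_format, of "i - 1"] 2(3)[rule_format, of "i - 1"] by auto
  have "x ` {1..s + 1} = x ` (\<lambda>i. i + 1) ` {0..s}" by simp
  also have "\<dots> = (\<lambda>i. x (i + 1)) ` {0..s}" by (rule image_image)
  also have "\<dots> = y ` {0..s}" using 1(3) by (intro image_cong) auto
  finally have vx: "verts C \<inter> verts C' = x ` {1..s + 1}" using y(2) by simp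
  have ae: "arcs C \<inter> arcs C' = e ` {1..s}" unfolding f(2)[symmetric] using 1(4) by (intro image_cong) auto
  have "x i = z i" if "i \<in> {1..s + 1}" for i using xy[OF that] by simp
  moreover have "e i = g i" if "i \<in> {1..s}" for i using 1(4) 2(4) that by simp
  ultimately show thesis by (rule that[OF 1(2) 2(2) s 1(1) 2(1) _ _ ae vx])
qed

text \<open>The outer cycle runs along \<open>C\<close> from the far end of the common path back to its start, and
  then backwards along \<open>C'\<close>.\<close>

lemma outer_cycle_labelling:
  assumes D: "weighted_oriented_graph D" "arcs C \<subseteq> arcs D" "arcs C' \<subseteq> arcs D"
    and L: "cycle_labelling C m x e" and L': "cycle_labelling C' n z g"
    and s: "1 \<le> s" "s < m" "s < n"
    and xz: "\<And>i. i \<in> {1..s + 1} \<Longrightarrow> x i = z i" and eg: "\<And>i. i \<in> {1..s} \<Longrightarrow> e i = g i"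
    and A: "arcs C \<inter> arcs C' = e ` {1..s}" and V: "verts C \<inter> verts C' = x ` {1..s + 1}"
  shows "\<exists>N X E. cycle_labelling (outer_cycle D C C') N X E"
proof -
  \<comment> \<open>\<open>a\<close> counts the edges of \<open>C\<close> off the common path.
    Positions 1 to \<open>a + 1\<close> run from \<open>x (s + 1)\<close> to
    \<open>x (m + 1) = x 1\<close>; later positions descend from \<open>z n\<close> to
    \<open>z (s + 2)\<close>, and position \<open>N + 1\<close> is \<open>z (s + 1)\<close>, the
    start.\<close>
  define a where "a = m - s"
  define N where "N = a + (n - s)"
  define X where "X i = (if i \<le> a + 1 then x (s + i) else z (n + a + 2 - i))" for i
  define E where "E i = (if i \<le> a then e (s + i) else g (n + a + 1 - i))" for i
  have m: "m = s + a" "1 \<le> a" using s by (auto simp: a_def)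
  have xm: "x (m + 1) = x 1" "x (Suc m) = x 1" "z (n + 1) = z 1" "z (Suc n) = z 1"
    using cycle_wrap[OF L] cycle_wrap[OF L'] by auto
  have xz1: "x 1 = z 1" using xz[of 1] by auto
  have gA: "g k \<notin> arcs C" if "k \<in> {s + 1..n}" for k
  proof
    assume "g k \<in> arcs C"
    then have "g k \<in> e ` {1..s}" using A cycle_arcs[OF L'] that by auto
    then obtain i where "i \<in> {1..s}" "g k = g i" using eg by auto
    then show False using cycle_inj_iff(2)[OF L', of k i] that s by auto
  qed
  have zV: "z k \<notin> verts C" if "k \<in> {s + 2..n}" for k
  proof
    assume "z k \<in> verts C"
    then have "z k \<in> x ` {1..s + 1}" using V cycle_verts[OF L'] that by auto
    then obtain i where "i \<in> {1..s + 1}" "z k = z i" using xz by auto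
    then show False using cycle_inj_iff(1)[OF L', of k i] that s by auto
  qed
  have xsi: "x (s + i) \<in> verts C" if "i \<in> {1..a + 1}" for i
    using that m xm cycle_verts[OF L] s by (cases "i = a + 1") auto
  have xinj: "x (s + i) = x (s + k) \<longleftrightarrow> i = k" if "i \<in> {1..a + 1}" "k \<in> {1..a + 1}" for i k
  proof -
    have *: "x (s + i) = x (if i = a + 1 then 1 else s + i)" if "i \<in> {1..a + 1}" for i
      using that m xm by auto
    have "x (s + i) = x (s + k) \<longleftrightarrow> (if i = a + 1 then 1 else s + i) = (if k = a + 1 then 1 else s + k)"
      unfolding *[OF that(1)] *[OF that(2)] using that m s by (intro cycle_inj_iff(1)[OF L]) auto
    also have "\<dots> \<longleftrightarrow> i = k" using s that by auto
    finally show ?thesis .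
  qed
  \<comment> \<open>Otherwise each cycle has a single edge off the common path. Both edges join
    \<open>x (s + 1)\<close> and \<open>x 1\<close>, so in a simple graph they coincide and would be
    common.\<close>
  have N3: "3 \<le> N"
  proof (rule ccontr)
    assume "\<not> 3 \<le> N"
    then have N: "a = 1" "n = s + 1" using m s by (auto simp: N_def)
    have "joins (e m) (x (s + 1)) (x 1)" "joins (g n) (x (s + 1)) (x 1)"
      using cycle_joins[OF L, of m] cycle_joins[OF L', of n] m N s xm xz[of "s + 1"] xz1 by auto
    moreover have "e m \<in> arcs D" "g n \<in> arcs D" using D cycle_arcs[OF L] cycle_arcs[OF L'] s by auto
    ultimately have "e m = g n" using D(1) by (auto simp: joins_def weighted_oriented_graph_def)
    moreover have "e m \<in> arcs C" using cycle_arcs[OF L] s by auto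
    ultimately show False using gA[of n] N by auto
  qed
  have Ej: "joins (E i) (X i) (X (i + 1))" if i: "i \<in> {1..N}" for i
  proof (cases "i \<le> a")
    case True
    then show ?thesis using cycle_joins[OF L, of "s + i"] i m by (auto simp: E_def X_def)
  next
    case False
    then have k: "n + a + 1 - i \<in> {1..n}" using i s by (auto simp: N_def)
    \<comment> \<open>At the junction \<open>i = a + 1\<close> both clauses of \<open>X\<close>
      agree: \<open>x (m + 1) = x 1 = z 1 = z (n + 1)\<close>.\<close>
    have "X i = z (n + a + 2 - i)"
      using False i xm xz1 m by (cases "i = a + 1") (auto simp: X_def)
    moreover have "X (i + 1) = z (n + a + 1 - i)" using False by (auto simp: X_def)
    moreover have "n + a + 1 - i + 1 = n + a + 2 - i" using k by auto
    ultimately show ?thesis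
      using cycle_joins[OF L' k] False joins_sym by (fastforce simp: E_def)
  qed
  have Xi: "inj_on X {1..N}"
  proof (rule linorder_inj_onI)
    fix i k assume ik: "i < k" "i \<in> {1..N}" "k \<in> {1..N}"
    show "X i \<noteq> X k"
    proof (cases "k \<le> a + 1")
      case True
      then show ?thesis using ik xinj[of i k] by (auto simp: X_def)
    next
      case False
      then have k: "n + a + 2 - k \<in> {s + 2..n}" using ik s by (auto simp: N_def)
      show ?thesis
      proof (cases "i \<le> a + 1")
        case True
        then show ?thesis using zV[OF k] xsi[of i] ik False by (auto simp: X_def)
      next
        case i: False
        then have "n + a + 2 - i \<in> {s + 2..n}" using ik s by (auto simp: N_def)
        then show ?thesis using cycle_inj_iff(1)[OF L', of "n + a + 2 - i" "n + a + 2 - k"] k i False ik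
          by (auto simp: X_def)
      qed
    qed
  qed auto
  have Ei: "inj_on E {1..N}"
  proof (rule linorder_inj_onI)
    fix i k assume ik: "i < k" "i \<in> {1..N}" "k \<in> {1..N}"
    show "E i \<noteq> E k"
    proof (cases "k \<le> a")
      case True
      then show ?thesis using ik cycle_inj_iff(2)[OF L, of "s + i" "s + k"] m by (auto simp: E_def)
    next
      case False
      then have k: "n + a + 1 - k \<in> {s + 1..n}" using ik s by (auto simp: N_def)
      show ?thesis
      proof (cases "i \<le> a")
        case True
        then have "e (s + i) \<in> arcs C" using cycle_arcs[OF L] m ik by auto
        then show ?thesis using gA[OF k] True False by (auto simp: E_def)
      next
        case i: False
        then have "n + a + 1 - i \<in> {s + 1..n}" using ik s by (auto simp: N_def)
        then show ?thesis using cycle_inj_iff(2)[OF L', of "n + a + 1 - i" "n + a + 1 - k"] k i False ik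
          by (auto simp: E_def)
      qed
    qed
  qed auto
  have "E ` {1..N} = E ` {1..a} \<union> E ` {a + 1..N}"
    unfolding image_Un[symmetric] by (rule arg_cong[where f = "image E"]) (auto simp: N_def)
  also have "E ` {1..a} = e ` {s + 1..m}"
  proof -
    have "E ` {1..a} = e ` (\<lambda>i. s + i) ` {1..a}" 
      unfolding image_image by (rule image_cong) (auto simp: E_def)
    also have "(\<lambda>i. s + i) ` {1..a} = {s + 1..m}"
      unfolding m(1) image_add_atLeastAtMost by (simp add: add.commute)
    finally show ?thesis .
  qed
  also have "E ` {a + 1..N} = g ` {s + 1..n}"
  proof -
    have "E ` {a + 1..N} = g ` (\<lambda>i. n + a + 1 - i) ` {a + 1..N}" 
      unfolding image_image by (rule image_cong) (auto simp: E_def)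
    also have "(\<lambda>i. n + a + 1 - i) ` {a + 1..N} = {s + 1..n}"
      using s by (intro bij_betw_imp_surj_on bij_betw_byWitness[where f' = "\<lambda>i. n + a + 1 - i"])
        (auto simp: N_def)
    finally show ?thesis .
  qed
  also have "e ` {s + 1..m} = arcs C - arcs C'"
  proof -
    have "arcs C - arcs C' = arcs C - e ` {1..s}" using A by blast
    then have "arcs C - arcs C' = e ` {1..m} - e ` {1..s}" unfolding cycle_arcs[OF L] .
    also have "\<dots> = e ` ({1..m} - {1..s})"
      using inj_on_image_set_diff[OF cycle_inj_arcs[OF L], of "{1..m}" "{1..s}"] s by auto
    also have "{1..m} - {1..s} = {s + 1..m}" by auto
    finally show ?thesis by simp
  qed
  also have "g ` {s + 1..n} = arcs C' - arcs C"
  proof -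
    have "arcs C' - arcs C = arcs C' - e ` {1..s}" using A by blast
    also have "e ` {1..s} = g ` {1..s}" using eg by (intro image_cong) auto
    finally have "arcs C' - arcs C = g ` {1..n} - g ` {1..s}" unfolding cycle_arcs[OF L'] .
    also have "\<dots> = g ` ({1..n} - {1..s})"
      using inj_on_image_set_diff[OF cycle_inj_arcs[OF L'], of "{1..n}" "{1..s}"] s by auto
    also have "{1..n} - {1..s} = {s + 1..n}" by auto
    finally show ?thesis by simp
  qed
  finally have im: "E ` {1..N} = (arcs C - arcs C') \<union> (arcs C' - arcs C)" .
  have "X (N + 1) = X 1"
    using s m xz[of "s + 1"] by (auto simp: X_def N_def)
  then show ?thesis
    unfolding outer_cycle_def edge_induced_def
    by (intro exI) (rule cycle_labellingI[OF N3 Xi _ Ei im Ej])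
qed

text \<open>Inner vertices of the common path, and of the part of \<open>C\<close> off it, meet only
  two edges of \<open>D\<close>. So \<open>F\<close> takes each of these two segments wholly or not
  at all: dropping the common path leaves the outer cycle, dropping the other segment leaves
  \<open>C'\<close>.\<close>

lemma leafless_avoiding_share_path:
  assumes D: "weighted_oriented_graph D"
    and C: "oriented_cycle C" and C': "oriented_cycle C'" and sh: "share_path D C C'"
    and F: "F \<subseteq> arcs D" "leafless F" "F \<noteq> {}" and a: "a \<in> arcs C" "a \<notin> F"
  shows "F = arcs C' \<or> F = arcs (outer_cycle D C C')"
proof -
  obtain s m n x e z g where L: "cycle_labelling C m x e" and L': "cycle_labelling C' n z g"
    and s: "1 \<le> s" "s < m" "s < n"
    and xz: "\<And>i. i \<in> {1..s + 1} \<Longrightarrow> x i = z i" and eg: "\<And>i. i \<in> {1..s} \<Longrightarrow> e i = g i"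
    and A: "arcs C \<inter> arcs C' = e ` {1..s}" and V: "verts C \<inter> verts C' = x ` {1..s + 1}"
    by (rule share_path_labels[OF C C' sh]) (rule that)
  have DU: "arcs D = arcs C \<union> arcs C'" using sh by (auto simp: share_path_def union_of_def)
  obtain N X E where LO: "cycle_labelling (outer_cycle D C C') N X E"
    using outer_cycle_labelling[OF D _ _ L L' s xz eg A V] DU by auto
  obtain j where j: "j \<in> {1..m}" "a = e j" using a cycle_arcs[OF L] by auto
  show ?thesis
  proof (cases "j \<le> s")
    case True
    have "e i \<in> F \<longleftrightarrow> e (i + 1) \<in> F" if i: "1 \<le> i" "i < s" for i
    proof (rule leafless_passage[OF F(2), of "x (i + 1)"])
      fix b assume b: "b \<in> F" "incident (x (i + 1)) b"
      show "b = e i \<or> b = e (i + 1)"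
      proof (cases "b \<in> arcs C")
        case False
        then have "b = g i \<or> b = g (i + 1)"
          using b cycle_incident[OF L', of i b] i s xz[of "i + 1"] F(1) DU by auto
        then show ?thesis using eg[of i] eg[of "i + 1"] i by auto
      qed (use cycle_incident[OF L] b i s in auto)
    qed (use cycle_incident_self[OF L, of i] cycle_incident_self[OF L, of "i + 1"] i s in auto)
    then have "e i \<in> F \<longleftrightarrow> e j \<in> F" if "i \<in> {1..s}" for i
      using membership_constant_on_interval[of 1 s e F i j] that j True by auto
    then have "F \<inter> (arcs C \<inter> arcs C') = {}" using A a(2) j by auto
    then have "F \<subseteq> arcs (outer_cycle D C C')"
      using F(1) DU by (auto simp: outer_cycle_def edge_induced_def)
    then show ?thesis using cycle_minimal[OF LO _ F(2,3)] by blast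
  next
    case False
    have "e i \<in> F \<longleftrightarrow> e (i + 1) \<in> F" if i: "s + 1 \<le> i" "i < m" for i
    proof (rule leafless_cycle_passage[OF L F(2)])
      fix b assume b: "b \<in> F" "incident (x (i + 1)) b"
      have "x (i + 1) \<noteq> x k" if "k \<in> {1..s + 1}" for k
        using cycle_inj_iff(1)[OF L, of "i + 1" k] that i by auto
      then have "x (i + 1) \<notin> x ` {1..s + 1}" by blast
      moreover have "x (i + 1) \<in> verts C" using cycle_verts[OF L] i by auto
      ultimately have "x (i + 1) \<notin> verts C'" using V by blast
      then show "b \<in> arcs C" using b cycle_incident_verts[OF L'] F(1) DU by blast
    qed (use i in auto)
    then have "e i \<in> F \<longleftrightarrow> e j \<in> F" if "i \<in> {s + 1..m}" for i
      using membership_constant_on_interval[of "s + 1" m e F i j] that j False by auto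
    then have no: "e i \<notin> F" if "i \<in> {s + 1..m}" for i using that a(2) j by auto
    have "F \<subseteq> arcs C'"
    proof
      fix b assume b: "b \<in> F"
      show "b \<in> arcs C'"
      proof (rule ccontr)
        assume b': "b \<notin> arcs C'"
        then obtain i where i: "i \<in> {1..m}" "b = e i" using b F(1) DU cycle_arcs[OF L] by auto
        have "e i \<in> arcs C'" if "i \<le> s" using A i that by (metis IntD2 atLeastAtMost_iff imageI)
        then have "\<not> i \<le> s" using b' i by blast
        then show False using no[of i] b i by simp
      qed
    qed
    then show ?thesis using cycle_minimal[OF L' _ F(2,3)] by blast
  qed
qed

section \<open>The complete list of cycles in each of the three cases\<close>

lemma cyclesD:
  assumes "C \<in> cycles D"
  shows "oriented_cycle C" "arcs C \<subseteq> arcs D" "weight C = weight D" "leafless (arcs C)" "arcs C \<noteq> {}"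
proof -
  show C: "oriented_cycle C" "arcs C \<subseteq> arcs D" "weight C = weight D"
    using assms by (auto simp: cycles_def subgraph_def)
  obtain n x e where L: "cycle_labelling C n x e" using C(1) by (rule oriented_cycleE)
  show "leafless (arcs C)" by (rule cycle_leafless[OF L])
  show "arcs C \<noteq> {}" using cycle_arcs[OF L] cycle_length[OF L] by auto
qed

lemma cycles_arcs_minimal:
  assumes "C \<in> cycles D" "F \<subseteq> arcs C" "leafless F" "F \<noteq> {}"
  shows "F = arcs C"
  using cyclesD(1)[OF assms(1)] cycle_minimal[OF _ assms(2-4)] by (auto elim: oriented_cycleE)

text \<open>Minimality turns the inclusion into equality of arcs, and the arcs determine the rest:
  the vertices are their ends and the weights are inherited from \<open>D\<close>.\<close>

lemma cycles_arcs_inj: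
  assumes C: "C \<in> cycles D" and C': "C' \<in> cycles D" and sub: "arcs C \<subseteq> arcs C'"
  shows "C = C'"
proof -
  have "arcs C = arcs C'" using cycles_arcs_minimal[OF C' sub] cyclesD[OF C] by blast
  moreover have "verts B = Field (arcs B)" if "B \<in> cycles D" for B
    using cyclesD(1)[OF that] by (rule oriented_cycleE) (rule cycle_Field)
  ultimately show ?thesis using cyclesD(3)[OF C] cyclesD(3)[OF C'] C C' by (intro wograph.equality) auto
qed

text \<open>All that the algebraic argument needs to know about the shape of the graph; it fails as
  soon as the cycle space has dimension three.\<close>

definition bicyclic :: "'v wograph \<Rightarrow> bool" where
  "bicyclic D \<longleftrightarrow> cycles D \<noteq> {} \<and> (\<forall>C\<in>cycles D. \<forall>a\<in>arcs C. \<forall>F\<subseteq>arcs D.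
     leafless F \<and> F \<noteq> {} \<and> a \<notin> F \<longrightarrow> F \<in> arcs ` cycles D)"

text \<open>A cycle containing all arcs of \<open>C\<close> equals \<open>C\<close>. Any other cycle
  misses an edge of \<open>C\<close>, and \<open>avoid\<close>, applied to its leafless arc set,
  finds it in the list. Thus the avoidance property gives the list of cycles and
  \<open>bicyclic\<close> together.\<close>

lemma cycles_eqI:
  assumes sub: "\<C> \<subseteq> cycles D" and C: "C \<in> \<C>"
    and avoid: "\<And>B a F. B \<in> \<C> \<Longrightarrow> a \<in> arcs B \<Longrightarrow> F \<subseteq> arcs D \<Longrightarrow> leafless F \<Longrightarrow> F \<noteq> {} \<Longrightarrow> a \<notin> F
      \<Longrightarrow> F \<in> arcs ` \<C>"
  shows "cycles D = \<C> \<and> bicyclic D"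
proof -
  have "B \<in> \<C>" if B: "B \<in> cycles D" for B
  proof (cases "arcs C \<subseteq> arcs B")
    case True
    then show ?thesis using cycles_arcs_inj B C sub by blast
  next
    case False
    then obtain a where "a \<in> arcs C" "a \<notin> arcs B" by blast
    then have "arcs B \<in> arcs ` \<C>" using avoid[OF C] cyclesD[OF B] by blast
    then obtain B' where "B' \<in> \<C>" "arcs B = arcs B'" by blast
    then show ?thesis using cycles_arcs_inj[OF B, of B'] sub by auto
  qed
  then have eq: "cycles D = \<C>" using sub by blast
  moreover have "bicyclic D"
    unfolding bicyclic_def eq using C avoid by blast
  ultimately show ?thesis by blast
qed

lemma union_cycle_mem:
  assumes "union_of D \<C>" "C \<in> \<C>" "oriented_cycle C" shows "C \<in> cycles D"
  using assms by (auto simp: union_of_def cycles_def)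

lemma share_vertex_cycles:
  assumes C: "oriented_cycle C" and C': "oriented_cycle C'" and sh: "share_vertex D C C'"
  shows "cycles D = {C, C'} \<and> bicyclic D"
proof (rule cycles_eqI[where C = C])
  have U: "union_of D {C, C'}" using sh by (auto simp: share_vertex_def)
  show "{C, C'} \<subseteq> cycles D" using union_cycle_mem[OF U] C C' by auto
  have sh': "share_vertex D C' C" using sh by (simp add: share_vertex_def insert_commute Int_commute)
  fix B a F
  assume B: "B \<in> {C, C'}" "a \<in> arcs B" and F: "F \<subseteq> arcs D" "leafless F" "F \<noteq> {}" "a \<notin> F"
  then show "F \<in> arcs ` {C, C'}"
    using leafless_avoiding_share_vertex[OF C C' sh F(1-3) _ F(4)]
      leafless_avoiding_share_vertex[OF C' C sh' F(1-3) _ F(4)] by blast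
qed simp

lemma connected_by_path_cycles:
  assumes C: "oriented_cycle C" and C': "oriented_cycle C'" and con: "connected_by_path D C C'"
  shows "cycles D = {C, C'} \<and> bicyclic D"
proof (rule cycles_eqI[where C = C])
  obtain P where U: "union_of D {C, C', P}" using con by (auto simp: connected_by_path_def)
  show "{C, C'} \<subseteq> cycles D" using union_cycle_mem[OF U] C C' by auto
  have con': "connected_by_path D C' C" by (rule connected_by_path_sym[OF con])
  fix B a F
  assume B: "B \<in> {C, C'}" "a \<in> arcs B" and F: "F \<subseteq> arcs D" "leafless F" "F \<noteq> {}" "a \<notin> F"
  then show "F \<in> arcs ` {C, C'}"
    using leafless_avoiding_connected[OF C C' con F(1-3) _ F(4)]
      leafless_avoiding_connected[OF C' C con' F(1-3) _ F(4)] by blast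
qed simp

lemma outer_cycle_sym: "outer_cycle D C C' = outer_cycle D C' C"
  by (simp add: outer_cycle_def Un_commute)

lemma outer_cycle_mem:
  assumes D: "weighted_oriented_graph D" and C: "oriented_cycle C" and C': "oriented_cycle C'"
    and sh: "share_path D C C'"
  shows "outer_cycle D C C' \<in> cycles D"
proof -
  obtain s m n x e z g where L: "cycle_labelling C m x e" and L': "cycle_labelling C' n z g"
    and s: "1 \<le> s" "s < m" "s < n"
    and xz: "\<And>i. i \<in> {1..s + 1} \<Longrightarrow> x i = z i" and eg: "\<And>i. i \<in> {1..s} \<Longrightarrow> e i = g i"
    and A: "arcs C \<inter> arcs C' = e ` {1..s}" and V: "verts C \<inter> verts C' = x ` {1..s + 1}"
    by (rule share_path_labels[OF C C' sh]) (rule that)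
  let ?O = "outer_cycle D C C'"
  have DU: "arcs D = arcs C \<union> arcs C'" using sh by (auto simp: share_path_def union_of_def)
  have "\<exists>N X E. cycle_labelling ?O N X E"
    using outer_cycle_labelling[OF D _ _ L L' s xz eg A V] DU by auto
  moreover have arcs: "arcs ?O \<subseteq> arcs D" using DU by (auto simp: outer_cycle_def edge_induced_def)
  moreover have "verts ?O = Field (arcs ?O)" "weight ?O = weight D"
    by (auto simp: outer_cycle_def edge_induced_def)
  moreover from arcs have "Field (arcs ?O) \<subseteq> verts D"
    using D by (fastforce simp: weighted_oriented_graph_def Field_def)
  moreover have "weighted_oriented_graph ?O"
  proof -
    have "finite (verts ?O)"
      using calculation D finite_subset unfolding weighted_oriented_graph_def by metis
    moreover have "arcs ?O \<subseteq> verts ?O \<times> verts ?O"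
      unfolding \<open>verts ?O = _\<close> by (auto simp: Field_def)
    moreover have "\<forall>(p, q)\<in>arcs ?O. p \<noteq> q \<and> (q, p) \<notin> arcs ?O"
      using D arcs unfolding weighted_oriented_graph_def by blast
    moreover have "\<forall>v\<in>verts ?O. 0 < weight ?O v"
      using D \<open>Field _ \<subseteq> _\<close> unfolding weighted_oriented_graph_def \<open>weight ?O = _\<close> \<open>verts ?O = _\<close> by blast
    ultimately show ?thesis unfolding weighted_oriented_graph_def by blast
  qed
  ultimately show ?thesis by (simp add: cycles_def subgraph_def oriented_cycle_def)
qed

lemma share_path_cycles:
  assumes D: "weighted_oriented_graph D"
    and C: "oriented_cycle C" and C': "oriented_cycle C'" and sh: "share_path D C C'"
  shows "cycles D = {C, C', outer_cycle D C C'} \<and> bicyclic D"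
proof (rule cycles_eqI[where C = C])
  have U: "union_of D {C, C'}" using sh by (auto simp: share_path_def)
  show "{C, C', outer_cycle D C C'} \<subseteq> cycles D"
    using union_cycle_mem[OF U] C C' outer_cycle_mem[OF D C C' sh] by auto
  have sh': "share_path D C' C" using sh by (simp add: share_path_def insert_commute Int_commute)
  fix B a F
  assume B: "B \<in> {C, C', outer_cycle D C C'}" "a \<in> arcs B"
    and F: "F \<subseteq> arcs D" "leafless F" "F \<noteq> {}" "a \<notin> F"
  \<comment> \<open>Edges of the outer cycle also lie on \<open>C\<close> or \<open>C'\<close>, so
    the avoidance lemma in its two orders covers all three cycles.\<close>
  have "a \<in> arcs C \<or> a \<in> arcs C'" using B by (auto simp: outer_cycle_def edge_induced_def)
  then show "F \<in> arcs ` {C, C', outer_cycle D C C'}"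
    using leafless_avoiding_share_path[OF D C C' sh F(1-3) _ F(4)]
      leafless_avoiding_share_path[OF D C' C sh' F(1-3) _ F(4)] outer_cycle_sym[of D C C'] by auto
qed simp

lemma share_path_arcs: "share_path D C C' \<Longrightarrow> arcs C \<inter> arcs C' \<noteq> {}"
  by (auto simp: share_path_def path_labelling_def edge_induced_def bij_betw_def)

text \<open>The common path has an edge, which lies on \<open>C\<close> and \<open>C'\<close> but
  not on the outer cycle.\<close>

lemma share_path_card:
  assumes D: "weighted_oriented_graph D"
    and C: "oriented_cycle C" and C': "oriented_cycle C'" and sh: "share_path D C C'" and ne: "C \<noteq> C'"
  shows "card (cycles D) = 3"
proof -
  have cyc: "cycles D = {C, C', outer_cycle D C C'}" using share_path_cycles[OF D C C' sh] by blast
  have "arcs C \<noteq> arcs (outer_cycle D C C')" "arcs C' \<noteq> arcs (outer_cycle D C C')"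
    using share_path_arcs[OF sh] by (auto simp: outer_cycle_def edge_induced_def)
  then have "C \<noteq> outer_cycle D C C'" "C' \<noteq> outer_cycle D C C'" by metis+
  then show ?thesis unfolding cyc using ne by simp
qed

section \<open>Kernel of the incidence matrix\<close>

definition kernel_vec :: "'v wograph \<Rightarrow> ('v \<times> 'v \<Rightarrow> int) \<Rightarrow> bool" where
  "kernel_vec D w \<longleftrightarrow> (\<forall>e. e \<notin> arcs D \<longrightarrow> w e = 0) \<and>
     (\<forall>v. (\<Sum>e\<in>arcs D. int (incidence D v e) * w e) = 0)"

lemma finite_arcs: "weighted_oriented_graph D \<Longrightarrow> finite (arcs D)"
  unfolding weighted_oriented_graph_def by (meson finite_SigmaI finite_subset)

lemma incidence_eq_0:
  assumes "weighted_oriented_graph D" "e \<in> arcs D"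
  shows "incidence D v e = 0 \<longleftrightarrow> \<not> incident v e"
  using assms by (fastforce simp: incidence_def incident_def weighted_oriented_graph_def)

lemma kernel_leafless:
  assumes D: "weighted_oriented_graph D" and w: "kernel_vec D w"
  shows "leafless {e. w e \<noteq> 0}"
  unfolding leafless_def
proof (intro allI ballI impI, rule ccontr)
  fix v e assume e: "e \<in> {e. w e \<noteq> 0}" "incident v e"
    and no: "\<not> (\<exists>e'\<in>{e. w e \<noteq> 0}. e' \<noteq> e \<and> incident v e')"
  have eD: "e \<in> arcs D" using e(1) w unfolding kernel_vec_def by blast
  have "(\<Sum>a\<in>arcs D. int (incidence D v a) * w a) = (\<Sum>a\<in>{e}. int (incidence D v a) * w a)"
    using eD no incidence_eq_0[OF D] finite_arcs[OF D] by (intro sum.mono_neutral_right) auto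
  then show False using w e incidence_eq_0[OF D eD] by (auto simp: kernel_vec_def)
qed

lemma kernel_vec_comb:
  assumes "kernel_vec D u" "kernel_vec D w"
  shows "kernel_vec D (\<lambda>e. c * u e + d * w e)"
proof -
  have "(\<Sum>e\<in>arcs D. int (incidence D v e) * (c * u e + d * w e)) =
    c * (\<Sum>e\<in>arcs D. int (incidence D v e) * u e) + d * (\<Sum>e\<in>arcs D. int (incidence D v e) * w e)" for v
    by (simp add: sum_distrib_left sum.distrib[symmetric] algebra_simps)
  then show ?thesis using assms by (simp add: kernel_vec_def)
qed

text \<open>Here \<open>A i\<close> and \<open>B i\<close> stand for the incidence entries of
  \<open>e i\<close> at \<open>x i\<close> and \<open>x (i + 1)\<close>. The equations express each
  \<open>W k\<close> through \<open>W 1\<close>, with denominators cleared; the closing equation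
  returns to \<open>W 1\<close>, which cancels. Both products are positive, so the sign (-1)^n must
  be 1.\<close>

lemma alternating_product:
  fixes A B W :: "nat \<Rightarrow> int"
  assumes pos: "\<And>i. i \<in> {1..n} \<Longrightarrow> 0 < A i" "\<And>i. i \<in> {1..n} \<Longrightarrow> 0 < B i"
    and n: "1 \<le> n" and W: "W 1 \<noteq> 0"
    and step: "\<And>i. 1 \<le> i \<Longrightarrow> i < n \<Longrightarrow> B i * W i + A (i + 1) * W (i + 1) = 0"
    and last: "B n * W n + A 1 * W 1 = 0"
  shows "even n \<and> prod A {1..n} = B n * prod B {1..n - 1}"
proof -
  have *: "prod A {2..k} * W k = (- 1) ^ (k - 1) * prod B {1..k - 1} * W 1" if "1 \<le> k" "k \<le> n" for k
    using that
  proof (induction k rule: dec_induct)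
    case base
    then show ?case by simp
  next
    case (step k)
    have A: "prod A {2..Suc k} = prod A {2..k} * A (Suc k)" using step by (simp add: prod.nat_ivl_Suc')
    have B: "prod B {1..k} = prod B {1..k - 1} * B k" using step by (cases k) (simp_all add: prod.nat_ivl_Suc')
    have "prod A {2..Suc k} * W (Suc k) = prod A {2..k} * (A (k + 1) * W (k + 1))" unfolding A by simp
    also have "A (k + 1) * W (k + 1) = - (B k * W k)" using assms(5)[of k] step by linarith
    also have "prod A {2..k} * - (B k * W k) = - B k * (prod A {2..k} * W k)" by simp
    also have "\<dots> = - B k * ((- 1) ^ (k - 1) * prod B {1..k - 1} * W 1)" using step by simp
    also have "\<dots> = (- 1) ^ k * prod B {1..k} * W 1" unfolding B using step by (cases k) simp_all
    finally show ?case by simp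
  qed
  have A: "prod A {1..n} = A 1 * prod A {2..n}" using n by (simp add: prod.atLeast_Suc_atMost numeral_2_eq_2)
  have "prod A {1..n} * W 1 = prod A {2..n} * (A 1 * W 1)" unfolding A by simp
  also have "A 1 * W 1 = - (B n * W n)" using last by linarith
  also have "prod A {2..n} * - (B n * W n) = - B n * (prod A {2..n} * W n)" by simp
  also have "\<dots> = - B n * ((- 1) ^ (n - 1) * prod B {1..n - 1} * W 1)" using *[of n] n by simp
  also have "\<dots> = (- 1) ^ n * (B n * prod B {1..n - 1}) * W 1" using n by (cases n) simp_all
  finally have eq: "prod A {1..n} = (- 1) ^ n * (B n * prod B {1..n - 1})" using W by simp
  have "0 < prod A {1..n}" "0 < B n * prod B {1..n - 1}"
    using pos n by (auto intro!: prod_pos mult_pos_pos)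
  then show ?thesis using eq by (cases "even n") auto
qed

section \<open>Balanced cycles as supports of kernel vectors\<close>

context
  fixes D C :: "'v wograph" and n x e
  assumes D: "weighted_oriented_graph D" and C: "C \<in> cycles D" and L: "cycle_labelling C n x e"
begin

lemma incidence_cycle: "incidence C = incidence D"
  using cyclesD(3)[OF C] by (auto simp: incidence_def fun_eq_iff)

lemma cycle_sum_pair:
  assumes w: "\<And>a. w a \<noteq> 0 \<Longrightarrow> a \<in> arcs C"
    and ab: "a \<in> arcs C" "b \<in> arcs C" "a \<noteq> b" "\<And>c. c \<in> arcs C \<Longrightarrow> incident v c \<Longrightarrow> c = a \<or> c = b"
  shows "(\<Sum>c\<in>arcs D. int (incidence D v c) * w c) = int (incidence C v a) * w a + int (incidence C v b) * w b"
proof -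
  have "(\<Sum>c\<in>arcs D. int (incidence D v c) * w c) = (\<Sum>c\<in>{a, b}. int (incidence D v c) * w c)"
    using ab w incidence_eq_0[OF D] finite_arcs[OF D] cyclesD(2)[OF C]
    by (intro sum.mono_neutral_right) auto
  then show ?thesis using ab by (simp add: incidence_cycle)
qed

lemma cycle_sum:
  assumes w: "\<And>a. w a \<noteq> 0 \<Longrightarrow> a \<in> arcs C"
  shows "1 \<le> i \<Longrightarrow> i < n \<Longrightarrow> (\<Sum>c\<in>arcs D. int (incidence D (x (i + 1)) c) * w c) =
      int (incidence C (x (i + 1)) (e i)) * w (e i) +
      int (incidence C (x (i + 1)) (e (i + 1))) * w (e (i + 1))" (is "_ \<Longrightarrow> _ \<Longrightarrow> ?A")
    and "(\<Sum>c\<in>arcs D. int (incidence D (x 1) c) * w c) =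
      int (incidence C (x 1) (e n)) * w (e n) + int (incidence C (x 1) (e 1)) * w (e 1)" (is ?B)
proof -
  assume i: "1 \<le> i" "i < n"
  show ?A
    using cycle_incident[OF L i] cycle_inj_iff(2)[OF L, of i "i + 1"] cycle_arcs[OF L] i
    by (intro cycle_sum_pair[OF w]) auto
next
  show ?B
    using cycle_incident_first[OF L] cycle_inj_iff(2)[OF L, of n 1] cycle_arcs[OF L] cycle_length[OF L]
    by (intro cycle_sum_pair[OF w]) auto
qed

lemma cycle_incidence_pos:
  assumes "i \<in> {1..n}"
  shows "0 < incidence C (x i) (e i)" "0 < incidence C (x (i + 1)) (e i)"
proof -
  have "e i \<in> arcs D" using cyclesD(2)[OF C] cycle_arcs[OF L] assms by auto
  then show "0 < incidence C (x i) (e i)" "0 < incidence C (x (i + 1)) (e i)"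
    unfolding incidence_cycle
    using incidence_eq_0[OF D] cycle_incident_self(1,2)[OF L, of i] assms by (simp_all add: neq0_conv[symmetric])
qed

lemma kernel_imp_product:
  assumes w: "kernel_vec D w" "\<And>a. w a \<noteq> 0 \<Longrightarrow> a \<in> arcs C" "w b \<noteq> 0"
  shows "even n \<and> (\<Prod>i=1..n. incidence C (x i) (e i)) =
       incidence C (x 1) (e n) * (\<Prod>i=1..n - 1. incidence C (x (i + 1)) (e i))"
proof -
  \<comment> \<open>By minimality the support is the whole cycle, so \<open>w (e 1)\<close> can be
    cancelled.\<close>
  have "{a. w a \<noteq> 0} = arcs C"
    by (rule cycles_arcs_minimal[OF C _ kernel_leafless[OF D w(1)]]) (use w(2,3) in blast)+
  then have w1: "w (e 1) \<noteq> 0" using cycle_arcs[OF L] cycle_length[OF L] by auto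
  have "even n \<and> (\<Prod>i=1..n. int (incidence C (x i) (e i))) =
       int (incidence C (x (n + 1)) (e n)) * (\<Prod>i=1..n - 1. int (incidence C (x (i + 1)) (e i)))"
  proof (rule alternating_product[where W = "\<lambda>i. w (e i)"])
    fix i assume "1 \<le> i" "i < n"
    from cycle_sum(1)[where w = w, OF w(2) this]
    show "int (incidence C (x (i + 1)) (e i)) * w (e i) +
      int (incidence C (x (i + 1)) (e (i + 1))) * w (e (i + 1)) = 0"
      using w(1) by (simp add: kernel_vec_def)
  next
    show "int (incidence C (x (n + 1)) (e n)) * w (e n) + int (incidence C (x 1) (e 1)) * w (e 1) = 0"
      using cycle_sum(2)[where w = w, OF w(2)] w(1) cycle_wrap(1)[OF L] by (simp add: kernel_vec_def)
  qed (use w1 cycle_incidence_pos cycle_length[OF L] in auto)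
  then show ?thesis
    unfolding cycle_wrap(1)[OF L] of_nat_prod[symmetric] of_nat_mult[symmetric] of_nat_eq_iff .
qed

lemma product_imp_kernel:
  assumes "even n" and eq: "(\<Prod>i=1..n. incidence C (x i) (e i)) =
       incidence C (x 1) (e n) * (\<Prod>i=1..n - 1. incidence C (x (i + 1)) (e i))"
  shows "\<exists>w. kernel_vec D w \<and> (\<forall>a. w a \<noteq> 0 \<longleftrightarrow> a \<in> arcs C)"
proof -
  define A B where "A i = int (incidence C (x i) (e i))" and "B i = int (incidence C (x (i + 1)) (e i))" for i
  \<comment> \<open>This solves the vertex equations without division: passing from
    \<open>W i\<close> to \<open>W (i + 1)\<close> trades the factor \<open>A (i + 1)\<close> for
    \<open>B i\<close> and flips the sign. Only the equation at \<open>x 1\<close> uses that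
    \<open>n\<close> is even and the products agree.\<close>
  define W where "W i = (- 1) ^ i * prod B {1..i - 1} * prod A {i + 1..n}" for i
  define w where "w a = (if a \<in> arcs C then W (the_inv_into {1..n} e a) else 0)" for a
  have n: "3 \<le> n" by (rule cycle_length[OF L])
  have pos: "0 < A i" "0 < B i" if "i \<in> {1..n}" for i
    using cycle_incidence_pos[OF that] by (auto simp: A_def B_def)
  have we: "w (e i) = W i" if "i \<in> {1..n}" for i
    using that the_inv_into_f_f[OF cycle_inj_arcs[OF L]] cycle_arcs[OF L] by (auto simp: w_def)
  have supp: "w a \<noteq> 0 \<longleftrightarrow> a \<in> arcs C" for a
  proof
    assume "a \<in> arcs C"
    then obtain i where i: "i \<in> {1..n}" "a = e i" using cycle_arcs[OF L] by auto
    have "0 < prod B {1..i - 1}" "0 < prod A {i + 1..n}"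
      using pos i by (auto intro!: prod_pos)
    then show "w a \<noteq> 0" using we[OF i(1)] i(2) by (simp add: W_def del: prod_zero_iff)
  qed (auto simp: w_def split: if_splits)
  have wC: "\<And>a. w a \<noteq> 0 \<Longrightarrow> a \<in> arcs C" using supp by blast
  have "(\<Sum>a\<in>arcs D. int (incidence D v a) * w a) = 0" for v
  proof (cases "v \<in> verts C")
    case False
    have "int (incidence D v a) * w a = 0" if "a \<in> arcs D" for a
      using that False wC[of a] cycle_incident_verts[OF L, of a v] incidence_eq_0[OF D that] by auto
    then show ?thesis by (intro sum.neutral) blast
  next
    case True
    then obtain j where j: "j \<in> {1..n}" "v = x j" using cycle_verts[OF L] by auto
    show ?thesis
    proof (cases "j = 1")
      case True
      have "B n * W n = prod A {1..n}"
        using eq \<open>even n\<close> cycle_wrap(1)[OF L] unfolding W_def A_def B_def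
        by (simp flip: of_nat_prod of_nat_mult)
      moreover have "A 1 * W 1 = - prod A {1..n}"
        using n by (simp add: W_def prod.atLeast_Suc_atMost[of "Suc 0" n])
      ultimately show ?thesis
        using cycle_sum(2)[where w = w, OF wC] we[of 1] we[of n] n cycle_wrap(1)[OF L] True j
        by (simp add: A_def B_def)
    next
      case False
      then obtain i where i: "j = i + 1" "1 \<le> i" "i < n" using j by (cases j) auto
      have "B i * W i = (- 1) ^ i * prod B {1..i} * prod A {i + 1..n}"
        using i by (cases i) (simp_all add: W_def prod.nat_ivl_Suc')
      moreover have "A (i + 1) * W (i + 1) = - ((- 1) ^ i * prod B {1..i} * prod A {i + 1..n})"
        using i by (simp add: W_def prod.atLeast_Suc_atMost[of "Suc i" n])
      ultimately show ?thesis
        using cycle_sum(1)[where w = w, OF wC i(2,3)] we[of i] we[of "i + 1"] i j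
        by (simp add: A_def B_def)
    qed
  qed
  moreover have "w a = 0" if "a \<notin> arcs D" for a
    using that wC cyclesD(2)[OF C] by blast
  ultimately have "kernel_vec D w" unfolding kernel_vec_def by blast
  then show ?thesis using supp by blast
qed

end

text \<open>\<open>kernel_imp_product\<close> applies to every labelling, while
  \<open>product_imp_kernel\<close> starts from any one. Hence the existential in
  \<open>balanced\<close> does not depend on the labelling chosen.\<close>

lemma balanced_if_kernel:
  assumes "weighted_oriented_graph D" "C \<in> cycles D"
    "kernel_vec D w" "\<And>a. w a \<noteq> 0 \<Longrightarrow> a \<in> arcs C" "w b \<noteq> 0"
  shows "balanced C"
proof -
  obtain n x e where "cycle_labelling C n x e" using cyclesD(1)[OF assms(2)] by (rule oriented_cycleE)
  then show ?thesis using kernel_imp_product[OF assms(1,2) _ assms(3-5)] unfolding balanced_def by blast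
qed

lemma kernel_if_balanced:
  assumes "weighted_oriented_graph D" "C \<in> cycles D" "balanced C"
  shows "\<exists>w. kernel_vec D w \<and> (\<forall>a. w a \<noteq> 0 \<longleftrightarrow> a \<in> arcs C)"
  using assms(3) product_imp_kernel[OF assms(1,2)] unfolding balanced_def by blast

text \<open>Rank at most one in coordinate form: as soon as some kernel vector is nonzero at
  \<open>a\<close>, the entry at \<open>a\<close> determines a kernel vector. Division with
  remainder uses it in this form.\<close>

lemma kernel_rank_le_1:
  assumes D: "weighted_oriented_graph D" and bi: "bicyclic D"
    and one: "\<exists>\<^sub>\<le>\<^sub>1C. C \<in> cycles D \<and> balanced C"
    and u: "kernel_vec D u" and v: "kernel_vec D v" "v a \<noteq> 0" "u a = 0"
  shows "u = (\<lambda>_. 0)"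
proof (rule ccontr)
  assume "u \<noteq> (\<lambda>_. 0)"
  then obtain b where b: "u b \<noteq> 0" by (meson ext)
  \<comment> \<open>For every edge \<open>k\<close> there is a nonzero kernel vector vanishing at
    \<open>k\<close>. The combination below is nonzero because \<open>u a = 0\<close> leaves the
    entry \<open>u k * v a\<close> at \<open>a\<close>.\<close>
  have elim: "\<exists>w c. kernel_vec D w \<and> w c \<noteq> 0 \<and> w k = 0" for k
  proof (cases "u k = 0")
    case True
    then show ?thesis using u b by blast
  next
    case False
    have "kernel_vec D (\<lambda>e. u k * v e + (- v k) * u e)" by (rule kernel_vec_comb[OF v(1) u])
    moreover have "u k * v a + (- v k) * u a \<noteq> 0" using False v by simp
    moreover have "u k * v k + (- v k) * u k = 0" by simp
    ultimately show ?thesis by blast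
  qed
  have avoid: "\<exists>C'\<in>cycles D. balanced C' \<and> k \<notin> arcs C'" if C: "C \<in> cycles D" "k \<in> arcs C" for C k
  proof -
    obtain w c where w: "kernel_vec D w" "w c \<noteq> 0" "w k = 0" using elim by blast
    let ?F = "{e. w e \<noteq> 0}"
    have "?F \<subseteq> arcs D" using w(1) by (auto simp: kernel_vec_def)
    moreover have "leafless ?F" by (rule kernel_leafless[OF D w(1)])
    moreover have "?F \<noteq> {}" "k \<notin> ?F" using w(2,3) by blast+
    ultimately have "?F \<in> arcs ` cycles D" using bi C unfolding bicyclic_def by blast
    then obtain C' where C': "C' \<in> cycles D" "?F = arcs C'" by blast
    have "balanced C'" by (rule balanced_if_kernel[OF D C'(1) w(1) _ w(2)]) (use C'(2) in blast)
    then show ?thesis using C' w(3) by blast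
  qed
  obtain C0 where C0: "C0 \<in> cycles D" using bi unfolding bicyclic_def by blast
  then obtain k0 where "k0 \<in> arcs C0" using cyclesD(5) by blast
  from avoid[OF C0 this] obtain C1 where C1: "C1 \<in> cycles D" "balanced C1" by blast
  obtain k1 where k1: "k1 \<in> arcs C1" using cyclesD(5)[OF C1(1)] by blast
  obtain C2 where C2: "C2 \<in> cycles D" "balanced C2" "k1 \<notin> arcs C2" using avoid[OF C1(1) k1] by blast
  have "C1 = C2" using one C1 C2 unfolding Uniq_def by blast
  then show False using k1 C2 by blast
qed

section \<open>Binomials in the toric ideal\<close>

text \<open>This is the exponent vector of the image of the monomial \<open>m\<close>, that is, the
  incidence matrix applied to \<open>m\<close>.\<close>

definition edge_degree :: "'v wograph \<Rightarrow> ('v \<times> 'v \<Rightarrow>\<^sub>0 nat) \<Rightarrow> 'v \<Rightarrow>\<^sub>0 nat" where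
  "edge_degree D m = (\<Sum>e\<in>Poly_Mapping.keys m. Poly_Mapping.single (fst e) (Poly_Mapping.lookup m e) +
     Poly_Mapping.single (snd e) (weight D (snd e) * Poly_Mapping.lookup m e))"

lemma Var_power: "(Var x ^ k :: ('x, 'k::comm_ring_1) mpoly) = Poly_Mapping.single (Poly_Mapping.single x k) 1"
  by (induction k) (simp_all add: Var_def mult_single flip: single_add)

lemma prod_monomials:
  "finite A \<Longrightarrow> (\<Prod>a\<in>A. Poly_Mapping.single (h a) (1 :: 'k::comm_ring_1)) =
    Poly_Mapping.single (\<Sum>a\<in>A. h a :: 'x \<Rightarrow>\<^sub>0 nat) 1"
  by (induction A rule: finite_induct) (simp_all add: mult_single)

lemma edge_monomial_power:
  "(edge_monomial D e ^ k :: ('v, 'k::field) mpoly) =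
    Poly_Mapping.single (Poly_Mapping.single (fst e) k + Poly_Mapping.single (snd e) (weight D (snd e) * k)) 1"
proof -
  have "edge_monomial D e ^ k = (Var (fst e) ^ k * Var (snd e) ^ (weight D (snd e) * k) :: ('v, 'k) mpoly)"
    by (simp add: edge_monomial_def power_mult_distrib power_mult)
  then show ?thesis by (simp add: Var_power mult_single)
qed

lemma insertion_edge_monomial:
  "insertion (edge_monomial D) (p :: ('v \<times> 'v, 'k::field) mpoly) =
    (\<Sum>m\<in>Poly_Mapping.keys p. Poly_Mapping.single (edge_degree D m) (Poly_Mapping.lookup p m))"
  by (simp add: insertion_def edge_monomial_power prod_monomials Const_def mult_single edge_degree_def)

lemma lookup_edge_degree:
  assumes D: "weighted_oriented_graph D" and m: "Poly_Mapping.keys m \<subseteq> arcs D"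
  shows "Poly_Mapping.lookup (edge_degree D m) v = (\<Sum>e\<in>arcs D. incidence D v e * Poly_Mapping.lookup m e)"
proof -
  have "Poly_Mapping.lookup (edge_degree D m) v =
    (\<Sum>e\<in>Poly_Mapping.keys m. incidence D v e * Poly_Mapping.lookup m e)"
    unfolding edge_degree_def lookup_sum
  proof (rule sum.cong)
    fix e assume "e \<in> Poly_Mapping.keys m"
    \<comment> \<open>Without loops the two summands of \<open>edge_degree\<close> belong to
      different vertices, matching the case split in \<open>incidence\<close>.\<close>
    then have "fst e \<noteq> snd e" using m D by (cases e) (auto simp: weighted_oriented_graph_def)
    then show "Poly_Mapping.lookup (Poly_Mapping.single (fst e) (Poly_Mapping.lookup m e) +
        Poly_Mapping.single (snd e) (weight D (snd e) * Poly_Mapping.lookup m e)) v =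
        incidence D v e * Poly_Mapping.lookup m e"
      by (auto simp: lookup_add lookup_single incidence_def when_def)
  qed simp
  also have "\<dots> = (\<Sum>e\<in>arcs D. incidence D v e * Poly_Mapping.lookup m e)"
    using m finite_arcs[OF D] by (intro sum.mono_neutral_left) (auto simp: in_keys_iff)
  finally show ?thesis .
qed

lemma edge_degree_eq_iff:
  assumes D: "weighted_oriented_graph D"
    and m: "Poly_Mapping.keys m \<subseteq> arcs D" "Poly_Mapping.keys m' \<subseteq> arcs D"
  shows "edge_degree D m = edge_degree D m' \<longleftrightarrow>
    kernel_vec D (\<lambda>e. int (Poly_Mapping.lookup m e) - int (Poly_Mapping.lookup m' e))"
proof -
  have 1: "Poly_Mapping.lookup m e = 0" "Poly_Mapping.lookup m' e = 0" if "e \<notin> arcs D" for e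
    using m that by (auto simp: in_keys_iff)
  have "edge_degree D m = edge_degree D m' \<longleftrightarrow> (\<forall>v. int (Poly_Mapping.lookup (edge_degree D m) v) =
      int (Poly_Mapping.lookup (edge_degree D m') v))"
    by (simp add: poly_mapping_eq_iff fun_eq_iff)
  then show ?thesis
    using 1 by (simp add: kernel_vec_def lookup_edge_degree[OF D] m right_diff_distrib sum_subtractf)
qed

lemma toric_ideal_iff:
  "p \<in> toric_ideal D \<longleftrightarrow> (\<forall>m\<in>Poly_Mapping.keys p. Poly_Mapping.keys m \<subseteq> arcs D) \<and>
     insertion (edge_monomial D) p = 0"
  by (simp add: toric_ideal_def a_kernel_def' poly_ring_def)

text \<open>The image of \<open>p\<close> collects coefficients by edge degree; a term alone in its
  degree would survive.\<close>

lemma toric_partner: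
  assumes p: "p \<in> (toric_ideal D :: ('v \<times> 'v, 'k::field) mpoly set)" and m: "m \<in> Poly_Mapping.keys p"
  shows "\<exists>m'\<in>Poly_Mapping.keys p. m' \<noteq> m \<and> edge_degree D m' = edge_degree D m"
proof (rule ccontr)
  assume no: "\<not> ?thesis"
  have "0 = Poly_Mapping.lookup (insertion (edge_monomial D) p) (edge_degree D m)"
    using p by (simp add: toric_ideal_iff)
  also have "\<dots> = (\<Sum>k\<in>Poly_Mapping.keys p. Poly_Mapping.lookup p k when edge_degree D k = edge_degree D m)"
    by (simp add: insertion_edge_monomial lookup_sum lookup_single)
  also have "\<dots> = (\<Sum>k\<in>{m}. Poly_Mapping.lookup p k when edge_degree D k = edge_degree D m)"
    using m no by (intro sum.mono_neutral_right) (auto simp: when_def)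
  also have "\<dots> = Poly_Mapping.lookup p m" by simp
  finally show False using m by (simp add: in_keys_iff)
qed

lemma insertion_edge_single:
  "insertion (edge_monomial D) (Poly_Mapping.single m (c :: 'k::field)) = Poly_Mapping.single (edge_degree D m) c"
  by (cases "c = 0") (simp_all add: insertion_edge_monomial)

lemma binomial_alt:
  "Poly_Mapping.single m (c :: 'k::field) - Poly_Mapping.single m' c = Poly_Mapping.single m c + Poly_Mapping.single m' (- c)"
  by (simp add: single_uminus)

lemma toric_binomial:
  assumes "Poly_Mapping.keys m \<subseteq> arcs D" "Poly_Mapping.keys m' \<subseteq> arcs D" "edge_degree D m = edge_degree D m'"
  shows "(Poly_Mapping.single m c - Poly_Mapping.single m' c :: ('v \<times> 'v, 'k::field) mpoly) \<in> toric_ideal D"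
proof -
  have "Poly_Mapping.keys (Poly_Mapping.single m c + Poly_Mapping.single m' (- c)) \<subseteq> {m, m'}"
    using Poly_Mapping.keys_add[of "Poly_Mapping.single m c" "Poly_Mapping.single m' (- c)"]
    by (auto split: if_splits)
  then show ?thesis
    using assms unfolding binomial_alt toric_ideal_iff
    by (auto simp: insertion_add insertion_edge_single simp flip: single_add)
qed

text \<open>A term and its partner of equal degree differ by a kernel vector supported on their
  variables. If \<open>Y\<close> carries only the zero vector, the partner is the term
  itself.\<close>

lemma toric_zero_on:
  assumes D: "weighted_oriented_graph D"
    and Y: "\<And>w b. kernel_vec D w \<Longrightarrow> {e. w e \<noteq> 0} \<subseteq> Y \<Longrightarrow> w b = 0"
    and p: "p \<in> (toric_ideal D :: ('v \<times> 'v, 'k::field) mpoly set)"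
    and pY: "\<And>m. m \<in> Poly_Mapping.keys p \<Longrightarrow> Poly_Mapping.keys m \<subseteq> Y"
  shows "p = 0"
proof (rule ccontr)
  assume "p \<noteq> 0"
  then obtain m where m: "m \<in> Poly_Mapping.keys p" by (metis keys_eq_empty all_not_in_conv)
  then obtain m' where m': "m' \<in> Poly_Mapping.keys p" "m' \<noteq> m" "edge_degree D m' = edge_degree D m"
    using toric_partner[OF p] by blast
  have sub: "Poly_Mapping.keys m \<subseteq> arcs D" "Poly_Mapping.keys m' \<subseteq> arcs D"
    using p m m' by (auto simp: toric_ideal_iff)
  let ?w = "\<lambda>e. int (Poly_Mapping.lookup m' e) - int (Poly_Mapping.lookup m e)"
  have "?w b = 0" for b
  proof (rule Y)
    show "kernel_vec D ?w" using edge_degree_eq_iff[OF D sub(2,1)] m'(3) by blast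
    show "{e. ?w e \<noteq> 0} \<subseteq> Y"
    proof
      fix e assume "e \<in> {e. ?w e \<noteq> 0}"
      then have "e \<in> Poly_Mapping.keys m \<union> Poly_Mapping.keys m'" by (auto simp: in_keys_iff)
      then show "e \<in> Y" using pY[OF m] pY[OF m'(1)] by blast
    qed
  qed
  then have "m' = m" by (intro poly_mapping_eqI) simp
  then show False using m'(2) by blast
qed

section \<open>Binomials of kernel vectors\<close>

definition pos_part :: "'v wograph \<Rightarrow> ('v \<times> 'v \<Rightarrow> int) \<Rightarrow> 'v \<times> 'v \<Rightarrow>\<^sub>0 nat" where
  "pos_part D w = (\<Sum>e\<in>arcs D. Poly_Mapping.single e (nat (w e)))"

lemma lookup_pos_part:
  assumes "weighted_oriented_graph D" "\<And>e. e \<notin> arcs D \<Longrightarrow> w e = 0"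
  shows "Poly_Mapping.lookup (pos_part D w) e = nat (w e)"
  using assms finite_arcs[OF assms(1)]
  by (simp add: pos_part_def lookup_sum lookup_single when_def sum.delta)

text \<open>The usual lattice binomial: the monomial of the positive part minus that of the negative
  part, the latter being the positive part of \<open>- w\<close>.\<close>

definition kernel_binomial :: "'v wograph \<Rightarrow> ('v \<times> 'v \<Rightarrow> int) \<Rightarrow> ('v \<times> 'v, 'k::field) mpoly" where
  "kernel_binomial D w =
     Poly_Mapping.single (pos_part D w) 1 - Poly_Mapping.single (pos_part D (\<lambda>e. - w e)) 1"

context
  fixes D :: "'v wograph" and w
  assumes D: "weighted_oriented_graph D" and w: "kernel_vec D w"
begin

lemma lookup_pos_parts:
  "Poly_Mapping.lookup (pos_part D w) e = nat (w e)"
  "Poly_Mapping.lookup (pos_part D (\<lambda>e. - w e)) e = nat (- w e)"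
proof -
  have "w a = 0" if "a \<notin> arcs D" for a using w that unfolding kernel_vec_def by blast
  then show "Poly_Mapping.lookup (pos_part D w) e = nat (w e)"
    "Poly_Mapping.lookup (pos_part D (\<lambda>e. - w e)) e = nat (- w e)"
    by (simp_all add: lookup_pos_part[OF D])
qed

lemma keys_pos_parts:
  "Poly_Mapping.keys (pos_part D w) \<subseteq> {e. w e \<noteq> 0}"
  "Poly_Mapping.keys (pos_part D (\<lambda>e. - w e)) \<subseteq> {e. w e \<noteq> 0}"
  by (auto simp: in_keys_iff lookup_pos_parts)

lemma kernel_support: "{e. w e \<noteq> 0} \<subseteq> arcs D"
  using w unfolding kernel_vec_def by blast

lemma kernel_binomial_toric: "kernel_binomial D w \<in> toric_ideal D"
proof -
  have "(\<lambda>e. int (nat (w e)) - int (nat (- w e))) = w" by (auto simp: fun_eq_iff)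
  then have "edge_degree D (pos_part D w) = edge_degree D (pos_part D (\<lambda>e. - w e))"
    using edge_degree_eq_iff[OF D] keys_pos_parts kernel_support w
    by (simp add: lookup_pos_parts subset_trans)
  then show ?thesis
    unfolding kernel_binomial_def
    using keys_pos_parts kernel_support by (intro toric_binomial) (blast intro: subset_trans)+
qed

lemma kernel_binomial_keys:
  assumes "m \<in> Poly_Mapping.keys (kernel_binomial D w)" shows "Poly_Mapping.keys m \<subseteq> {e. w e \<noteq> 0}"
proof -
  have "m \<in> {pos_part D w, pos_part D (\<lambda>e. - w e)}"
    using assms Poly_Mapping.keys_add unfolding kernel_binomial_def binomial_alt by fastforce
  then show ?thesis using keys_pos_parts by auto
qed

lemma kernel_binomial_nonzero:
  assumes "w b \<noteq> 0" shows "kernel_binomial D w \<noteq> (0 :: ('v \<times> 'v, 'k::field) mpoly)"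
proof
  assume "kernel_binomial D w = (0 :: ('v \<times> 'v, 'k) mpoly)"
  then have "Poly_Mapping.lookup (Poly_Mapping.single (pos_part D w) (1 :: 'k)) (pos_part D w) =
     Poly_Mapping.lookup (Poly_Mapping.single (pos_part D (\<lambda>e. - w e)) 1) (pos_part D w)"
    unfolding kernel_binomial_def by simp
  then have "pos_part D w = pos_part D (\<lambda>e. - w e)" by (auto simp: lookup_single when_def split: if_splits)
  then have "nat (w b) = nat (- w b)" using lookup_pos_parts by metis
  then show False using assms by linarith
qed

end

section \<open>Variables of a divisor\<close>

text \<open>The variables carry no linear order, so there is no monomial order to speak of leading
  monomials; an additive weight that separates the finitely many monomials at hand replaces it.\<close>

lemma additive_weight:
  fixes S :: "('x \<Rightarrow>\<^sub>0 nat) set"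
  assumes "finite V" "finite S"
  shows "\<exists>\<phi> :: ('x \<Rightarrow>\<^sub>0 nat) \<Rightarrow> nat. (\<forall>m m'. \<phi> (m + m') = \<phi> m + \<phi> m') \<and>
    (\<forall>m\<in>S. \<forall>m'\<in>S. \<phi> m = \<phi> m' \<longrightarrow> (\<forall>y\<in>V. Poly_Mapping.lookup m y = Poly_Mapping.lookup m' y))"
  using assms(1)
proof (induction V rule: finite_induct)
  case empty
  show ?case by (intro exI[of _ "\<lambda>_. 0"]) simp
next
  case (insert y V)
  then obtain \<phi> :: "('x \<Rightarrow>\<^sub>0 nat) \<Rightarrow> nat" where add: "\<And>m m'. \<phi> (m + m') = \<phi> m + \<phi> m'"
    and inj: "\<And>m m' z. m \<in> S \<Longrightarrow> m' \<in> S \<Longrightarrow> \<phi> m = \<phi> m' \<Longrightarrow> z \<in> V \<Longrightarrow>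
      Poly_Mapping.lookup m z = Poly_Mapping.lookup m' z" by blast
  \<comment> \<open>With \<open>K\<close> above all weights on \<open>S\<close>,
    \<open>?\<psi>\<close> is a two-digit number in base \<open>K\<close>: the remainder recovers
    \<open>\<phi>\<close> and the quotient the exponent of \<open>y\<close>.\<close>
  obtain K where K: "\<And>m. m \<in> S \<Longrightarrow> \<phi> m < K"
    using finite_nat_set_iff_bounded[of "\<phi> ` S"] assms(2) by auto
  let ?\<psi> = "\<lambda>m. K * Poly_Mapping.lookup m y + \<phi> m"
  have eq: "\<phi> m = \<phi> m' \<and> Poly_Mapping.lookup m y = Poly_Mapping.lookup m' y"
    if "m \<in> S" "m' \<in> S" "?\<psi> m = ?\<psi> m'" for m m'
  proof -
    have "\<phi> m = ?\<psi> m mod K" "\<phi> m' = ?\<psi> m' mod K" using K that(1,2) by simp_all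
    then have "\<phi> m = \<phi> m'" using that(3) by metis
    moreover have "0 < K" using K that by fastforce
    ultimately show ?thesis using that by simp
  qed
  then have "\<forall>m\<in>S. \<forall>m'\<in>S. ?\<psi> m = ?\<psi> m' \<longrightarrow>
      (\<forall>z\<in>insert y V. Poly_Mapping.lookup m z = Poly_Mapping.lookup m' z)"
    using inj by blast
  moreover have "\<forall>m m'. ?\<psi> (m + m') = ?\<psi> m + ?\<psi> m'"
    by (simp add: add lookup_add algebra_simps)
  ultimately show ?case by (intro exI[of _ ?\<psi>] conjI)
qed

text \<open>The same base expansion once more, now with \<open>y\<close> as top digit over a weight
  separating all of \<open>S\<close>. On \<open>S\<close> this acts like a monomial order with
  \<open>y\<close> as the largest variable.\<close>

lemma additive_weight_priority:
  fixes S :: "('x \<Rightarrow>\<^sub>0 nat) set"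
  assumes S: "finite S"
  obtains \<phi> :: "('x \<Rightarrow>\<^sub>0 nat) \<Rightarrow> nat" where "\<And>m m'. \<phi> (m + m') = \<phi> m + \<phi> m'" "inj_on \<phi> S"
    "\<And>m m'. m \<in> S \<Longrightarrow> m' \<in> S \<Longrightarrow> Poly_Mapping.lookup m y < Poly_Mapping.lookup m' y \<Longrightarrow> \<phi> m < \<phi> m'"
proof -
  let ?V = "\<Union>m\<in>S. Poly_Mapping.keys m"
  have "finite ?V" using S by auto
  from additive_weight[OF this S] obtain \<phi> :: "('x \<Rightarrow>\<^sub>0 nat) \<Rightarrow> nat"
    where add: "\<forall>m m'. \<phi> (m + m') = \<phi> m + \<phi> m'"
      and inj: "\<forall>m\<in>S. \<forall>m'\<in>S. \<phi> m = \<phi> m' \<longrightarrow> (\<forall>z\<in>?V. Poly_Mapping.lookup m z = Poly_Mapping.lookup m' z)"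
    by (elim exE conjE) (rule that)
  obtain K where K: "\<And>m. m \<in> S \<Longrightarrow> \<phi> m < K"
    using finite_nat_set_iff_bounded[of "\<phi> ` S"] S by auto
  let ?\<psi> = "\<lambda>m. K * Poly_Mapping.lookup m y + \<phi> m"
  have less: "?\<psi> m < ?\<psi> m'" if "m \<in> S" "m' \<in> S" "Poly_Mapping.lookup m y < Poly_Mapping.lookup m' y" for m m'
  proof -
    have "?\<psi> m < K * Suc (Poly_Mapping.lookup m y)" using K[OF that(1)] by simp
    also have "\<dots> \<le> K * Poly_Mapping.lookup m' y" using that(3) by (intro mult_le_mono2) simp
    finally show ?thesis by simp
  qed
  have "inj_on ?\<psi> S"
  proof (rule inj_onI)
    fix m m' assume m: "m \<in> S" "m' \<in> S" "?\<psi> m = ?\<psi> m'"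
    then have "Poly_Mapping.lookup m y = Poly_Mapping.lookup m' y"
      using less[of m m'] less[of m' m] by (metis less_irrefl linorder_neqE_nat)
    then have \<phi>: "\<phi> m = \<phi> m'" using m(3) by simp
    show "m = m'"
    proof (rule poly_mapping_eqI)
      fix z show "Poly_Mapping.lookup m z = Poly_Mapping.lookup m' z"
      proof (cases "z \<in> ?V")
        case False
        then have "z \<notin> Poly_Mapping.keys m" "z \<notin> Poly_Mapping.keys m'" using m(1,2) by blast+
        then show ?thesis by (simp add: in_keys_iff)
      qed (use inj m(1,2) \<phi> in blast)
    qed
  qed
  moreover have "?\<psi> (m + m') = ?\<psi> m + ?\<psi> m'" for m m'
    by (simp add: add lookup_add algebra_simps)
  ultimately show thesis using that[of ?\<psi>] less by blast
qed

text \<open>Any other pair of terms has strictly smaller total weight, so by additivity it cannot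
  produce \<open>a + b\<close>. The coefficient there is a product of two nonzero field
  elements.\<close>

lemma leading_monomial_mult:
  fixes p q :: "('x, 'k::field) mpoly" and \<phi> :: "('x \<Rightarrow>\<^sub>0 nat) \<Rightarrow> nat"
  assumes add: "\<And>m m'. \<phi> (m + m') = \<phi> m + \<phi> m'"
    and a: "a \<in> Poly_Mapping.keys p" "\<And>m. m \<in> Poly_Mapping.keys p \<Longrightarrow> m \<noteq> a \<Longrightarrow> \<phi> m < \<phi> a"
    and b: "b \<in> Poly_Mapping.keys q" "\<And>m. m \<in> Poly_Mapping.keys q \<Longrightarrow> m \<noteq> b \<Longrightarrow> \<phi> m < \<phi> b"
  shows "a + b \<in> Poly_Mapping.keys (p * q)"
proof -
  let ?ca = "Poly_Mapping.lookup p a" and ?cb = "Poly_Mapping.lookup q b"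
  define p' where "p' = p - Poly_Mapping.single a ?ca"
  define q' where "q' = q - Poly_Mapping.single b ?cb"
  have p': "m \<in> Poly_Mapping.keys p \<and> m \<noteq> a" if "m \<in> Poly_Mapping.keys p'" for m
    using that by (auto simp: p'_def in_keys_iff lookup_minus lookup_single when_def split: if_splits)
  have q': "m \<in> Poly_Mapping.keys q \<and> m \<noteq> b" if "m \<in> Poly_Mapping.keys q'" for m
    using that by (auto simp: q'_def in_keys_iff lookup_minus lookup_single when_def split: if_splits)
  have "p * q = Poly_Mapping.single (a + b) (?ca * ?cb) + Poly_Mapping.single a ?ca * q' + p' * q"
    by (simp add: p'_def q'_def mult_single algebra_simps)
  moreover have "a + b \<notin> Poly_Mapping.keys (Poly_Mapping.single a ?ca * q')"
  proof
    assume "a + b \<in> Poly_Mapping.keys (Poly_Mapping.single a ?ca * q')"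
    then obtain c d where "a + b = c + d" "c \<in> Poly_Mapping.keys (Poly_Mapping.single a ?ca)"
      "d \<in> Poly_Mapping.keys q'" using Poly_Mapping.keys_mult by blast
    then show False using q'[of d] by (auto split: if_splits)
  qed
  moreover have "a + b \<notin> Poly_Mapping.keys (p' * q)"
  proof
    assume "a + b \<in> Poly_Mapping.keys (p' * q)"
    then obtain c d where cd: "a + b = c + d" "c \<in> Poly_Mapping.keys p'" "d \<in> Poly_Mapping.keys q"
      using Poly_Mapping.keys_mult by blast
    then have "\<phi> c < \<phi> a" "\<phi> d \<le> \<phi> b" using p'[of c] a b(2)[of d] by (auto simp: le_less)
    moreover have "\<phi> a + \<phi> b = \<phi> c + \<phi> d" using cd(1) add by metis
    ultimately show False by simp
  qed
  ultimately have "Poly_Mapping.lookup (p * q) (a + b) = ?ca * ?cb"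
    by (simp add: lookup_add in_keys_iff)
  then show ?thesis using a(1) b(1) by (simp add: in_keys_iff)
qed

lemma leading_monomial:
  fixes \<phi> :: "'a \<Rightarrow> nat"
  assumes "finite A" "A \<noteq> {}" "inj_on \<phi> A"
  obtains a where "a \<in> A" "\<And>m. m \<in> A \<Longrightarrow> m \<noteq> a \<Longrightarrow> \<phi> m < \<phi> a"
proof -
  obtain a where a: "a \<in> A" "\<And>m. m \<in> A \<Longrightarrow> \<phi> m \<le> \<phi> a"
    using Max_in[of "\<phi> ` A"] Max_ge[of "\<phi> ` A"] assms(1,2) by (metis (no_types) finite_imageI image_is_empty imageE image_eqI)
  then have "\<phi> m < \<phi> a" if "m \<in> A" "m \<noteq> a" for m
    using that assms(3) by (metis inj_onD le_neq_implies_less)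
  then show thesis using that a(1) by blast
qed

text \<open>With a weight that puts \<open>y\<close> first, the leading monomial \<open>b\<close> of
  \<open>q\<close> has at least the \<open>y\<close>-exponent of \<open>m\<close>. So
  \<open>y\<close> occurs in \<open>a + b\<close>, a monomial of the product.\<close>

lemma factor_variables:
  fixes p q :: "('x, 'k::field) mpoly"
  assumes pq: "p * q \<noteq> 0" and X: "\<And>m. m \<in> Poly_Mapping.keys (p * q) \<Longrightarrow> Poly_Mapping.keys m \<subseteq> X"
    and m: "m \<in> Poly_Mapping.keys q"
  shows "Poly_Mapping.keys m \<subseteq> X"
proof
  fix y assume y: "y \<in> Poly_Mapping.keys m"
  let ?S = "Poly_Mapping.keys p \<union> Poly_Mapping.keys q"
  have "finite ?S" by simp
  then obtain \<phi> :: "('x \<Rightarrow>\<^sub>0 nat) \<Rightarrow> nat" where add: "\<And>m m'. \<phi> (m + m') = \<phi> m + \<phi> m'"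
    and inj: "inj_on \<phi> ?S" and less: "\<And>m m'. m \<in> ?S \<Longrightarrow> m' \<in> ?S \<Longrightarrow>
      Poly_Mapping.lookup m y < Poly_Mapping.lookup m' y \<Longrightarrow> \<phi> m < \<phi> m'"
    by (rule additive_weight_priority[of ?S y]) (rule that)
  have "p \<noteq> 0" "q \<noteq> 0" using pq by auto
  then obtain a b where a: "a \<in> Poly_Mapping.keys p" "\<And>m. m \<in> Poly_Mapping.keys p \<Longrightarrow> m \<noteq> a \<Longrightarrow> \<phi> m < \<phi> a"
    and b: "b \<in> Poly_Mapping.keys q" "\<And>m. m \<in> Poly_Mapping.keys q \<Longrightarrow> m \<noteq> b \<Longrightarrow> \<phi> m < \<phi> b"
    using leading_monomial[OF finite_keys, of p \<phi>] leading_monomial[OF finite_keys, of q \<phi>] inj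
    by (metis inj_on_Un keys_eq_empty)
  have "\<not> Poly_Mapping.lookup b y < Poly_Mapping.lookup m y"
  proof
    assume l: "Poly_Mapping.lookup b y < Poly_Mapping.lookup m y"
    then have "\<phi> b < \<phi> m" using less[of b m] b(1) m by blast
    moreover have "m \<noteq> b" using l by auto
    ultimately show False using b(2)[OF m] by simp
  qed
  moreover have "0 < Poly_Mapping.lookup m y" using y by (simp add: in_keys_iff)
  ultimately have "y \<in> Poly_Mapping.keys (a + b)" by (simp add: in_keys_iff lookup_add)
  then show "y \<in> X" using X[OF leading_monomial_mult[OF add a b]] by blast
qed

section \<open>Principality\<close>

lemma carrier_poly_ring:
  "p \<in> carrier (poly_ring X) \<longleftrightarrow> (\<forall>m\<in>Poly_Mapping.keys p. Poly_Mapping.keys m \<subseteq> X)"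
  by (simp add: poly_ring_def)

lemma mem_PIdl_iff:
  "p \<in> PIdl\<^bsub>poly_ring X\<^esub> f \<longleftrightarrow> (\<exists>h\<in>carrier (poly_ring X). p = h * f)"
  by (auto simp: cgenideal_def poly_ring_def)

lemma principal_imp_generator:
  assumes "principalideal I (poly_ring X :: ('x, 'k::comm_ring_1) mpoly ring)"
  shows "\<exists>g\<in>carrier (poly_ring X). I = PIdl\<^bsub>poly_ring X\<^esub> g"
proof -
  interpret cring "poly_ring X :: ('x, 'k) mpoly ring" by (rule cring_poly_ring)
  show ?thesis using principalideal.generate[OF assms] cgenideal_eq_genideal by metis
qed

lemma principal_imp_unique_balanced:
  assumes D: "weighted_oriented_graph D"
    and pr: "principalideal (toric_ideal D :: ('v \<times> 'v, 'k::field) mpoly set) (poly_ring (arcs D))"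
  shows "\<exists>\<^sub>\<le>\<^sub>1C. C \<in> cycles D \<and> balanced C"
  unfolding Uniq_def
proof (intro allI impI, elim conjE)
  fix C C' assume C: "C \<in> cycles D" "balanced C" and C': "C' \<in> cycles D" "balanced C'"
  obtain g :: "('v \<times> 'v, 'k) mpoly" where g: "toric_ideal D = PIdl\<^bsub>poly_ring (arcs D)\<^esub> g"
    using principal_imp_generator[OF pr] by blast
  have "g \<in> PIdl\<^bsub>poly_ring (arcs D)\<^esub> g"
    unfolding mem_PIdl_iff by (rule bexI[of _ 1]) (simp_all add: carrier_poly_ring)
  then have gI: "g \<in> toric_ideal D" using g by simp
  have vars: "g \<noteq> 0 \<and> (\<forall>m\<in>Poly_Mapping.keys g. Poly_Mapping.keys m \<subseteq> arcs B)"
    if B: "B \<in> cycles D" "balanced B" for B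
  proof -
    obtain w where w: "kernel_vec D w" "\<forall>a. w a \<noteq> 0 \<longleftrightarrow> a \<in> arcs B"
      using kernel_if_balanced[OF D B] by blast
    then have supp: "{e. w e \<noteq> 0} = arcs B" by blast
    obtain b where "b \<in> arcs B" using cyclesD(5)[OF B(1)] by blast
    then have "w b \<noteq> 0" using w(2) by blast
    then have ne: "kernel_binomial D w \<noteq> (0 :: ('v \<times> 'v, 'k) mpoly)"
      by (rule kernel_binomial_nonzero[OF D w(1)])
    have "(kernel_binomial D w :: ('v \<times> 'v, 'k) mpoly) \<in> toric_ideal D"
      by (rule kernel_binomial_toric[OF D w(1)])
    then obtain h where h: "kernel_binomial D w = h * g" unfolding g mem_PIdl_iff by blast
    have keys: "Poly_Mapping.keys m \<subseteq> arcs B" if "m \<in> Poly_Mapping.keys (h * g)" for m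
      using kernel_binomial_keys[OF D w(1)] that unfolding h[symmetric] supp by blast
    have "Poly_Mapping.keys m \<subseteq> arcs B" if "m \<in> Poly_Mapping.keys g" for m
      using ne that unfolding h by (intro factor_variables[of h g "arcs B" m] keys)
    moreover have "g \<noteq> 0" using ne h by auto
    ultimately show ?thesis by blast
  qed
  show "C = C'"
  proof (rule ccontr)
    assume "C \<noteq> C'"
    have "g = 0"
    proof (rule toric_zero_on[OF D _ gI, of "arcs C \<inter> arcs C'"])
      fix w b assume w: "kernel_vec D w" "{e. w e \<noteq> 0} \<subseteq> arcs C \<inter> arcs C'"
      show "w b = 0"
      proof (rule ccontr)
        assume "w b \<noteq> 0"
        then have "{e. w e \<noteq> 0} \<noteq> {}" by blast
        \<comment> \<open>The leafless support lies in both cycles, so minimality makes it equal to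
          each of them, although distinct cycles have distinct arcs.\<close>
        then have "{e. w e \<noteq> 0} = arcs C" "{e. w e \<noteq> 0} = arcs C'"
          using cycles_arcs_minimal[OF C(1) _ kernel_leafless[OF D w(1)]]
            cycles_arcs_minimal[OF C'(1) _ kernel_leafless[OF D w(1)]] w(2) by blast+
        then show False using cycles_arcs_inj[OF C(1) C'(1)] \<open>C \<noteq> C'\<close> by blast
      qed
    qed (use vars[OF C] vars[OF C'] in blast)
    then show False using vars[OF C] by blast
  qed
qed

text \<open>If two monomials differ by \<open>k\<close> times \<open>v\<close> with \<open>k\<close>
  nonnegative, \<open>k\<close> exchanges of the positive part of \<open>v\<close> for its negative
  part lead from one to the other, each costing a monomial multiple of the binomial. An arbitrary
  element is reduced by cancelling a term against its partner of equal degree.\<close>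

lemma toric_generated_by_binomial:
  assumes D: "weighted_oriented_graph D" and v: "kernel_vec D v"
    and multiple: "\<And>u. kernel_vec D u \<Longrightarrow> \<exists>q. \<forall>e. u e = q * v e"
  shows "toric_ideal D = PIdl\<^bsub>poly_ring (arcs D)\<^esub> (kernel_binomial D v :: ('v \<times> 'v, 'k::field) mpoly)"
proof
  let ?f = "kernel_binomial D v :: ('v \<times> 'v, 'k) mpoly"
  let ?J = "PIdl\<^bsub>poly_ring (arcs D)\<^esub> ?f"
  interpret R: cring "poly_ring (arcs D) :: ('v \<times> 'v, 'k) mpoly ring" by (rule cring_poly_ring)
  have f: "?f \<in> toric_ideal D" by (rule kernel_binomial_toric[OF D v])
  have fc: "?f \<in> carrier (poly_ring (arcs D))" using f by (simp add: toric_ideal_iff carrier_poly_ring)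
  show "?J \<subseteq> toric_ideal D"
  proof
    fix p assume "p \<in> ?J"
    then obtain h where h: "h \<in> carrier (poly_ring (arcs D))" "p = h * ?f" unfolding mem_PIdl_iff by blast
    have "p \<in> carrier (poly_ring (arcs D))" using R.m_closed[OF h(1) fc] h(2) by (simp add: poly_ring_def)
    moreover have "insertion (edge_monomial D) p = 0" using f by (simp add: h(2) insertion_mult toric_ideal_iff)
    ultimately show "p \<in> toric_ideal D" by (simp add: toric_ideal_iff carrier_poly_ring)
  qed
  have Jadd: "p + q \<in> ?J" if pq: "p \<in> ?J" "q \<in> ?J" for p q
  proof -
    obtain h k where h: "h \<in> carrier (poly_ring (arcs D))" "p = h * ?f"
      and k: "k \<in> carrier (poly_ring (arcs D))" "q = k * ?f" using pq unfolding mem_PIdl_iff by blast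
    have "h + k \<in> carrier (poly_ring (arcs D))" using R.a_closed[OF h(1) k(1)] by (simp add: poly_ring_def)
    moreover have "p + q = (h + k) * ?f" using h(2) k(2) by (simp add: distrib_right)
    ultimately show ?thesis unfolding mem_PIdl_iff by blast
  qed
  have step: "Poly_Mapping.single m c - Poly_Mapping.single m' c \<in> ?J"
    if "Poly_Mapping.keys m \<subseteq> arcs D"
      "\<And>e. int (Poly_Mapping.lookup m e) - int (Poly_Mapping.lookup m' e) = int k * v e" for m m' c k
    using that
  proof (induction k arbitrary: m)
    case 0
    then have "m = m'" by (intro poly_mapping_eqI) simp
    then show ?case unfolding mem_PIdl_iff by (intro bexI[of _ 0]) (simp_all add: carrier_poly_ring)
  next
    case (Suc k)
    let ?p = "pos_part D v" and ?n = "pos_part D (\<lambda>e. - v e)"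
    note lp = lookup_pos_parts[OF D v]
    \<comment> \<open>The exchange is possible: where \<open>v e\<close> is positive, the exponent
      of \<open>m\<close> is at least \<open>Suc k\<close> times \<open>v e\<close>, because
      exponents of \<open>m'\<close> are nonnegative.\<close>
    have ge: "nat (v e) \<le> Poly_Mapping.lookup m e" for e
    proof (cases "v e \<le> 0")
      case False
      have "v e * 1 \<le> v e * int (Suc k)" using False by (intro mult_left_mono) auto
      also have "\<dots> \<le> int (Poly_Mapping.lookup m e)" using Suc.prems(2)[of e] by (simp add: mult.commute)
      finally show ?thesis by simp
    qed simp
    define r where "r = m - ?p"
    have r: "Poly_Mapping.lookup r e = Poly_Mapping.lookup m e - nat (v e)" for e
      by (simp add: r_def lookup_minus lp)
    have m: "m = r + ?p" by (rule poly_mapping_eqI) (use ge in \<open>simp add: lookup_add r lp\<close>)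
    have rk: "Poly_Mapping.keys r \<subseteq> arcs D" using Suc.prems(1) by (auto simp: in_keys_iff r)
    have "Poly_Mapping.single (r + ?n) c - Poly_Mapping.single m' c \<in> ?J"
    proof (rule Suc.IH)
      show "Poly_Mapping.keys (r + ?n) \<subseteq> arcs D"
        using Poly_Mapping.keys_add[of r ?n] rk keys_pos_parts(2)[OF D v] kernel_support[OF D v] by blast
      fix e
      have "int (nat (v e)) - int (nat (- v e)) = v e" by simp
      then show "int (Poly_Mapping.lookup (r + ?n) e) - int (Poly_Mapping.lookup m' e) = int k * v e"
        using Suc.prems(2)[of e] ge[of e] by (simp add: lookup_add r lp of_nat_diff algebra_simps)
    qed
    moreover have "Poly_Mapping.single r c * ?f \<in> ?J"
      unfolding mem_PIdl_iff using rk by (intro bexI[of _ "Poly_Mapping.single r c"]) (auto simp: carrier_poly_ring)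
    ultimately have "Poly_Mapping.single r c * ?f + (Poly_Mapping.single (r + ?n) c - Poly_Mapping.single m' c) \<in> ?J"
      by (rule Jadd[rotated])
    then show ?case by (simp add: m kernel_binomial_def right_diff_distrib mult_single)
  qed
  have binomial: "Poly_Mapping.single m c - Poly_Mapping.single m' c \<in> ?J"
    if keys: "Poly_Mapping.keys m \<subseteq> arcs D" "Poly_Mapping.keys m' \<subseteq> arcs D"
      and deg: "edge_degree D m = edge_degree D m'" for m m' c
  proof -
    obtain q where q: "\<And>e. int (Poly_Mapping.lookup m e) - int (Poly_Mapping.lookup m' e) = q * v e"
      using multiple edge_degree_eq_iff[OF D keys] deg by blast
    show ?thesis
    proof (cases "0 \<le> q")
      case True
      then show ?thesis using step[OF keys(1), of m' "nat q" c] q by simp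
    next
      case False
      \<comment> \<open>For negative \<open>q\<close> the two monomials swap roles, and the
        coefficient \<open>- c\<close> restores the binomial.\<close>
      have "int (Poly_Mapping.lookup m' e) - int (Poly_Mapping.lookup m e) = int (nat (- q)) * v e" for e
        using q[of e] False by simp
      from step[OF keys(2) this, of "- c"] show ?thesis by (simp add: single_uminus)
    qed
  qed
  have "p \<in> ?J" if "p \<in> toric_ideal D" for p :: "('v \<times> 'v, 'k) mpoly"
    using that
  proof (induction "card (Poly_Mapping.keys p)" arbitrary: p rule: less_induct)
    case less
    show ?case
    proof (cases "p = 0")
      case True
      then show ?thesis unfolding mem_PIdl_iff by (intro bexI[of _ 0]) (simp_all add: carrier_poly_ring)
    next
      case False
      then obtain m where m: "m \<in> Poly_Mapping.keys p" by (metis keys_eq_empty all_not_in_conv)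
      then obtain m' where m': "m' \<in> Poly_Mapping.keys p" "m' \<noteq> m" "edge_degree D m' = edge_degree D m"
        using toric_partner[OF less.prems] by blast
      have keys: "Poly_Mapping.keys m \<subseteq> arcs D" "Poly_Mapping.keys m' \<subseteq> arcs D"
        using less.prems m m' by (auto simp: toric_ideal_iff)
      define c where "c = Poly_Mapping.lookup p m"
      define b where "b = Poly_Mapping.single m c - Poly_Mapping.single m' c"
      have b: "b \<in> ?J" unfolding b_def by (rule binomial[OF keys m'(3)[symmetric]])
      have bI: "- b \<in> toric_ideal D"
        using toric_binomial[OF keys(2,1) m'(3), of c] by (simp add: b_def)
      \<comment> \<open>Subtracting \<open>b\<close> cancels the term at \<open>m\<close> and
        otherwise changes only the coefficient at \<open>m'\<close>, already in the support, so the
        number of terms drops.\<close>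
      have sub: "Poly_Mapping.keys (p - b) \<subseteq> Poly_Mapping.keys p - {m}"
        using m' by (auto simp: in_keys_iff b_def c_def lookup_minus lookup_single when_def split: if_splits)
      have "p - b \<in> toric_ideal D"
        using less.prems bI sub unfolding toric_ideal_iff
        using insertion_add[of "edge_monomial D" p "- b"] by auto
      moreover have "card (Poly_Mapping.keys (p - b)) < card (Poly_Mapping.keys p)"
        using sub m by (intro psubset_card_mono) auto
      ultimately have "p - b \<in> ?J" using less.hyps by blast
      then show ?thesis using Jadd[OF _ b, of "p - b"] by simp
    qed
  qed
  then show "toric_ideal D \<subseteq> ?J" by blast
qed

text \<open>A kernel vector \<open>v\<close> with least nonzero absolute value at \<open>a\<close>
  generates the kernel: the remainder of \<open>u\<close> modulo \<open>v\<close> has a smaller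
  entry at \<open>a\<close>, hence zero there, and \<open>kernel_rank_le_1\<close> makes it
  vanish.\<close>

lemma unique_balanced_imp_principal:
  assumes D: "weighted_oriented_graph D" and bi: "bicyclic D"
    and one: "\<exists>\<^sub>\<le>\<^sub>1C. C \<in> cycles D \<and> balanced C"
  shows "principalideal (toric_ideal D :: ('v \<times> 'v, 'k::field) mpoly set) (poly_ring (arcs D))"
proof -
  have "\<exists>v. kernel_vec D v \<and> (\<forall>u. kernel_vec D u \<longrightarrow> (\<exists>q. \<forall>e. u e = q * v e))"
  proof (cases "\<exists>v a. kernel_vec D v \<and> v a \<noteq> 0")
    case False
    have "kernel_vec D (\<lambda>_. 0)" by (simp add: kernel_vec_def)
    \<comment> \<open>For a trivial kernel the zero vector serves as generator; its binomial is
      0.\<close>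
    then show ?thesis using False by (intro exI[of _ "\<lambda>_. 0"]) simp
  next
    case True
    then obtain v0 a where "kernel_vec D v0 \<and> v0 a \<noteq> 0" by blast
    then obtain v where v: "kernel_vec D v" "v a \<noteq> 0"
      and least: "\<And>u. kernel_vec D u \<Longrightarrow> u a \<noteq> 0 \<Longrightarrow> nat \<bar>v a\<bar> \<le> nat \<bar>u a\<bar>"
      using ex_has_least_nat[of "\<lambda>v. kernel_vec D v \<and> v a \<noteq> 0" v0 "\<lambda>v. nat \<bar>v a\<bar>"] by blast
    have "\<forall>e. u e = (u a div v a) * v e" if u: "kernel_vec D u" for u
    proof -
      define r where "r e = 1 * u e + (- (u a div v a)) * v e" for e
      have r: "kernel_vec D r" unfolding r_def by (rule kernel_vec_comb[OF u v(1)])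
      have "r a = u a mod v a" by (simp add: r_def minus_div_mult_eq_mod)
      then have "\<bar>r a\<bar> < \<bar>v a\<bar>" using v(2) by (simp add: abs_mod_less)
      then have "r a = 0" using least[OF r] by fastforce
      then have "r = (\<lambda>_. 0)" using kernel_rank_le_1[OF D bi one r v] by blast
      then show ?thesis by (simp add: r_def fun_eq_iff)
    qed
    then show ?thesis using v(1) by blast
  qed
  then obtain v where v: "kernel_vec D v" "\<And>u. kernel_vec D u \<Longrightarrow> \<exists>q. \<forall>e. u e = q * v e" by blast
  interpret R: cring "poly_ring (arcs D) :: ('v \<times> 'v, 'k) mpoly ring" by (rule cring_poly_ring)
  have "kernel_binomial D v \<in> carrier (poly_ring (arcs D) :: ('v \<times> 'v, 'k) mpoly ring)"
  proof -
    have "(kernel_binomial D v :: ('v \<times> 'v, 'k) mpoly) \<in> toric_ideal D" by (rule kernel_binomial_toric[OF D v(1)])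
    then show ?thesis by (simp add: toric_ideal_iff carrier_poly_ring)
  qed
  then have "principalideal (PIdl\<^bsub>poly_ring (arcs D)\<^esub> (kernel_binomial D v)) (poly_ring (arcs D) :: ('v \<times> 'v, 'k) mpoly ring)"
    by (rule R.cgenideal_is_principalideal)
  moreover have "toric_ideal D = PIdl\<^bsub>poly_ring (arcs D)\<^esub> (kernel_binomial D v :: ('v \<times> 'v, 'k) mpoly)"
    by (rule toric_generated_by_binomial[OF D v])
  ultimately show ?thesis by simp
qed

theorem theorem5p1:
  fixes D C\<^sub>m C\<^sub>n :: "'v wograph"
  assumes "weighted_oriented_graph D"
    and "oriented_cycle C\<^sub>m" and "oriented_cycle C\<^sub>n" and "C\<^sub>m \<noteq> C\<^sub>n"
    and "share_vertex D C\<^sub>m C\<^sub>n \<or> share_path D C\<^sub>m C\<^sub>n \<or> connected_by_path D C\<^sub>m C\<^sub>n"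
  shows "(principalideal (toric_ideal D :: ('v \<times> 'v, 'k::field) mpoly set) (poly_ring (arcs D)) \<longleftrightarrow>
            (\<exists>\<^sub>\<le>\<^sub>1C. C \<in> cycles D \<and> balanced C)) \<and>
         (share_vertex D C\<^sub>m C\<^sub>n \<or> connected_by_path D C\<^sub>m C\<^sub>n \<longrightarrow> cycles D = {C\<^sub>m, C\<^sub>n}) \<and>
         (share_path D C\<^sub>m C\<^sub>n \<longrightarrow>
            cycles D = {C\<^sub>m, C\<^sub>n, outer_cycle D C\<^sub>m C\<^sub>n} \<and> card (cycles D) = 3)"
proof -
  note D = assms(1) and C = assms(2,3)
  have "bicyclic D"
    using assms(5) share_vertex_cycles[OF C] share_path_cycles[OF D C] connected_by_path_cycles[OF C] by blast
  then have "principalideal (toric_ideal D :: ('v \<times> 'v, 'k) mpoly set) (poly_ring (arcs D)) \<longleftrightarrow>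
      (\<exists>\<^sub>\<le>\<^sub>1C. C \<in> cycles D \<and> balanced C)"
    using principal_imp_unique_balanced[OF D] unique_balanced_imp_principal[OF D] by blast
  moreover have "cycles D = {C\<^sub>m, C\<^sub>n}" if "share_vertex D C\<^sub>m C\<^sub>n \<or> connected_by_path D C\<^sub>m C\<^sub>n"
    using that share_vertex_cycles[OF C] connected_by_path_cycles[OF C] by blast
  moreover have "cycles D = {C\<^sub>m, C\<^sub>n, outer_cycle D C\<^sub>m C\<^sub>n} \<and> card (cycles D) = 3"
    if "share_path D C\<^sub>m C\<^sub>n"
    using share_path_cycles[OF D C that] share_path_card[OF D C that assms(4)] by blast
  ultimately show ?thesis by blast
qed

end
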